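(* Let $(\mathcal{B},\mathbb{C},F,\mathbb{H})$ be a geminal category and $\Box=\gamma_{\mathbb C}\circ F:\mathcal B\to\mathcal B$. Then the pair $(\mathcal{B},\Box)$ can be equipped with the following additional structures: 1. A natural transformation $\delta:\Box\Rightarrow\Box\Box$ satisfying the co-associative law $(\delta\Box)\circ\delta=(\Box\delta)\circ\delta$. 2. A family of functions $(-)^{\dagger}_{A,B}:\mathcal{B}(B\times\Box A,A)\to\mathcal{B}(\Box B,\Box A)$ (for $A,B\in\mathcal B$), natural in $B\in\mathcal{B}$, such that for any $f:B\times\Box A\to A$ the morphism $f^\dagger:\Box B\to\Box A$ equals the composite $$\Box B\xrightarrow{\langle\mathrm{id},\,\delta_A\circ f^\dagger\rangle}\Box B\times\Box\Box A\xrightarrow{\ \cong\ }\Box(B\times\Box A)\xrightarrow{\ \Box f\ }\Box A,$$ where the isomorphism is the canonical one (since $\Box$ preserves finite products).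
   Context: Internal categories. Let $\mathcal B$ be a locally small category with finite limits (a terminal object $1$ and pullbacks). A $\mathcal B$-internal category $\mathbb C$ has an object of objects $|\mathbb C|$, an object of morphisms $|\mathbb C^{\to}|$, morphisms $\mathrm{dom},\mathrm{cod}:|\mathbb C^\to|\to|\mathbb C|$, identities $e:|\mathbb C|\to|\mathbb C^\to|$ and a composition $\circ$ defined on the object of composable pairs (written in diagrammatic order), satisfying the usual axioms. An internal functor $\mathbb H:\mathbb C\to\mathbb D$ is a pair $|\mathbb H|:|\mathbb C|\to|\mathbb D|$, $|\mathbb H^\to|:|\mathbb C^\to|\to|\mathbb D^\to|$ commuting with this structure. A global object $X\in_1\mathbb C$ is a morphism $X:1\to|\mathbb C|$; $\mathbb HX=|\mathbb H|\circ X$. The hom-object $\mathbb C(X,Y)$ is the pullback of $\langle\mathrm{dom},\mathrm{cod}\rangle:|\mathbb C^\to|\to|\mathbb C|\times|\mathbb C|$ along $\langle X,Y\rangle:1\to|\mathbb C|\times|\mathbb C|$; its global elements (morphisms from $1$) are identified with global elements of $|\mathbb C^\to|$ with domain $X$ and codomain $Y$. Composition induces $\circ_{\mathbb C}:\mathbb C(X,Y)\times\mathbb C(Y,Z)\to\mathbb C(X,Z)$ and $\mathbb H$ induces $\mathbb H_{X,Y}:\mathbb C(X,Y)\to\mathbb D(\mathbb HX,\mathbb HY)$. The underlying category $\Gamma\mathbb C$ has global objects as objects and global elements of $\mathbb C(X,Y)$ as morphisms $X\to Y$; $\mathbb H$ induces a functor $\Gamma\mathbb H$. $\mathbb C$ has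 chosen finite limits if it is equipped with an internal chosen terminal object $1_{\mathbb C}\in_1\mathbb C$ and internal chosen pullbacks (given by morphisms of $\mathcal B$ expressing a choice of pullback squares and of mediating arrows, satisfying the evident internal equations); then $\Gamma\mathbb C$ has induced chosen finite limits. The global section functor is $\gamma_{\mathbb C}=\mathbb C(1_{\mathbb C},-):\Gamma\mathbb C\to\mathcal B$ (acting on morphisms by $\circ_{\mathbb C}$); it preserves finite limits. If $G:\mathcal B\to\mathcal B'$ preserves finite limits, $G\mathbb C$ is the $\mathcal B'$-internal category obtained by applying $G$ to all data of $\mathbb C$ (with induced chosen finite limits), $G\mathbb H$ is defined similarly for internal functors, and $G^{\#}_{\mathbb C}:\Gamma\mathbb C\to\Gamma G\mathbb C$ is the functor sending a global object $X$ to $1\cong G1\xrightarrow{GX}G|\mathbb C|$, and likewise on global morphisms; canonically $(G\mathbb C)(G^\#X,G^\#Y)\cong G(\mathbb C(X,Y))$. Pre-geminal category. It consists of: (I) a category $\mathcal B$ with chosen finite limits; (II) a $\mathcal B$-internal category $\mathbb C$ with chosen finite limits; (III) a functor $F:\mathcal B\to\Gamma\mathbb C$ strictly preserving the chosen finite limits; put $\Box=\gamma_{\mathbb C}\circ F:\mathcal B\to\mathcal B$, so $\Box A=\mathbb C(1_{\mathbb C},FA)$ (it preserves finite limits); (IV) a $\mathcal B$-internal functor $\mathbb H:\mathbb C\to\Box\mathbb C$ satisfying $\Gamma\mathbb H\circ F=F^{\#}_{\mathbb C}\circ F$, where the codomain $\Gamma F\mathbb C$ of $F^\#_{\mathbb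 C}$ is identified with $\Gamma\Box\mathbb C=\Gamma\gamma_{\mathbb C}F\mathbb C$ by the canonical isomorphism. Unfolded: with $u:1\cong\Box1$ the unique isomorphism, $|\mathbb H|\circ FA=\Box(FA)\circ u$ for every object $A$ of $\mathcal B$, and $|\mathbb H^\to|\circ Ff=\Box(Ff)\circ u$ for every morphism $f$ of $\mathcal B$, where $FA:1\to|\mathbb C|$ and $Ff:1\to|\mathbb C^\to|$. In particular $\mathbb HFA=\Box^\#FA$, whence a canonical isomorphism $(\Box\mathbb C)(\mathbb HFA,\mathbb HFB)\cong\Box(\mathbb C(FA,FB))$ for all $A,B\in\mathcal B$ (and $F1=1_{\mathbb C}$). Geminal category. It is a pre-geminal category such that $\mathbb H$ strictly preserves the chosen finite limits and $\Box\mathbb H\circ\mathbb H=\mathbb H^{\#}_{F\mathbb C}\circ\mathbb H$ as internal functors $\mathbb C\to\Box\Box\mathbb C$. Here $\mathbb H^\#_{F\mathbb C}:\Box\mathbb C=\gamma_{\mathbb C}F\mathbb C\to\Box\Box\mathbb C$ is the $\mathcal B$-internal functor given on objects by $\sigma_{|\mathbb C|}:\Box|\mathbb C|\to\Box\Box|\mathbb C|$ and on morphisms by $\sigma_{|\mathbb C^\to|}:\Box|\mathbb C^\to|\to\Box\Box|\mathbb C^\to|$, where for $A\in\mathcal B$, $\sigma_A$ is the composite $\Box A=\mathbb C(1_{\mathbb C},FA)\xrightarrow{\mathbb H_{1_{\mathbb C},FA}}(\Box\mathbb C)(\mathbb H1_{\mathbb C},\mathbb HFA)\cong\Box(\mathbb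 C(1_{\mathbb C},FA))=\Box\Box A$. Naturality in $B$ of $(-)^\dagger$ means $(f\circ(g\times\mathrm{id}_{\Box A}))^\dagger=f^\dagger\circ\Box g$ for all $g:B'\to B$ and $f:B\times\Box A\to A$. *)

theory Defs
  imports Main
begin

section \<open>Categories with chosen finite limits\<close>

text \<open>
  External composition is written in the usual order: \<open>g \<cdot> f\<close> is \<open>g\<close> after \<open>f\<close>.
\<close>

record ('o, 'm) cat =
  Obj :: "'o set"
  Arr :: "'m set"
  Dom :: "'m \<Rightarrow> 'o"
  Cod :: "'m \<Rightarrow> 'o"
  Id :: "'o \<Rightarrow> 'm"
  Comp :: "'m \<Rightarrow> 'm \<Rightarrow> 'm" (infixr "\<cdot>\<index>" 70)

definition Hom :: "('o, 'm, 'x) cat_scheme \<Rightarrow> 'o \<Rightarrow> 'o \<Rightarrow> 'm set" where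
  "Hom B X Y = {f \<in> Arr B. Dom B f = X \<and> Cod B f = Y}"

locale category =
  fixes B :: "('o, 'm, 'x) cat_scheme" (structure)
  assumes dom_obj: "f \<in> Arr B \<Longrightarrow> Dom B f \<in> Obj B"
    and cod_obj: "f \<in> Arr B \<Longrightarrow> Cod B f \<in> Obj B"
    and id_hom: "X \<in> Obj B \<Longrightarrow> Id B X \<in> Hom B X X"
    and comp_hom: "\<lbrakk>f \<in> Hom B X Y; g \<in> Hom B Y Z\<rbrakk> \<Longrightarrow> g \<cdot> f \<in> Hom B X Z"
    and id_left: "f \<in> Hom B X Y \<Longrightarrow> Id B Y \<cdot> f = f"
    and id_right: "f \<in> Hom B X Y \<Longrightarrow> f \<cdot> Id B X = f"
    and comp_assoc: "\<lbrakk>f \<in> Hom B W X; g \<in> Hom B X Y; h \<in> Hom B Y Z\<rbrakk>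
      \<Longrightarrow> (h \<cdot> g) \<cdot> f = h \<cdot> (g \<cdot> f)"

definition is_iso :: "('o, 'm, 'x) cat_scheme \<Rightarrow> 'm \<Rightarrow> bool" where
  "is_iso B f \<longleftrightarrow> f \<in> Arr B \<and>
    (\<exists>g \<in> Hom B (Cod B f) (Dom B f).
      g \<cdot>\<^bsub>B\<^esub> f = Id B (Dom B f) \<and> f \<cdot>\<^bsub>B\<^esub> g = Id B (Cod B f))"

definition is_terminal :: "('o, 'm, 'x) cat_scheme \<Rightarrow> 'o \<Rightarrow> bool" where
  "is_terminal B T \<longleftrightarrow> T \<in> Obj B \<and> (\<forall>X \<in> Obj B. \<exists>!h. h \<in> Hom B X T)"

definition is_pullback :: "('o, 'm, 'x) cat_scheme \<Rightarrow> 'm \<Rightarrow> 'm \<Rightarrow> 'm \<Rightarrow> 'm \<Rightarrow> bool" where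
  "is_pullback B f g p q \<longleftrightarrow>
    f \<in> Arr B \<and> g \<in> Arr B \<and> Cod B f = Cod B g \<and>
    p \<in> Arr B \<and> q \<in> Arr B \<and> Dom B p = Dom B q \<and>
    Cod B p = Dom B f \<and> Cod B q = Dom B g \<and> f \<cdot>\<^bsub>B\<^esub> p = g \<cdot>\<^bsub>B\<^esub> q \<and>
    (\<forall>X \<in> Obj B. \<forall>a \<in> Hom B X (Dom B f). \<forall>b \<in> Hom B X (Dom B g).
      f \<cdot>\<^bsub>B\<^esub> a = g \<cdot>\<^bsub>B\<^esub> b \<longrightarrow>
      (\<exists>!h. h \<in> Hom B X (Dom B p) \<and> p \<cdot>\<^bsub>B\<^esub> h = a \<and> q \<cdot>\<^bsub>B\<^esub> h = b))"

text \<open>The morphism into a pullback with projections \<open>p\<close>, \<open>q\<close> whose components are \<open>a\<close>, \<open>b\<close>.\<close>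

definition lift :: "('o, 'm, 'x) cat_scheme \<Rightarrow> 'm \<Rightarrow> 'm \<Rightarrow> 'm \<Rightarrow> 'm \<Rightarrow> 'm" where
  "lift B p q a b =
    (THE h. h \<in> Hom B (Dom B a) (Dom B p) \<and> p \<cdot>\<^bsub>B\<^esub> h = a \<and> q \<cdot>\<^bsub>B\<^esub> h = b)"

text \<open>
  A choice of finite limits is a choice of a terminal object and of a pullback square for
  every cospan; the chosen pullback object of \<open>f\<close>, \<open>g\<close> is the domain of \<open>Pb1 f g\<close>.
\<close>

record ('o, 'm) lexcat = "('o, 'm) cat" +
  One :: 'o
  Pb1 :: "'m \<Rightarrow> 'm \<Rightarrow> 'm"
  Pb2 :: "'m \<Rightarrow> 'm \<Rightarrow> 'm"

locale lex_category = category B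
  for B :: "('o, 'm, 'x) lexcat_scheme" (structure) +
  assumes one_terminal: "is_terminal B (One B)"
    and pb_pullback: "\<lbrakk>f \<in> Arr B; g \<in> Arr B; Cod B f = Cod B g\<rbrakk>
      \<Longrightarrow> is_pullback B f g (Pb1 B f g) (Pb2 B f g)"

definition bang :: "('o, 'm, 'x) lexcat_scheme \<Rightarrow> 'o \<Rightarrow> 'm" where
  "bang B X = (THE h. h \<in> Hom B X (One B))"

text \<open>Binary products are the chosen pullbacks over the chosen terminal object.\<close>

definition Pr1 :: "('o, 'm, 'x) lexcat_scheme \<Rightarrow> 'o \<Rightarrow> 'o \<Rightarrow> 'm" where
  "Pr1 B X Y = Pb1 B (bang B X) (bang B Y)"

definition Pr2 :: "('o, 'm, 'x) lexcat_scheme \<Rightarrow> 'o \<Rightarrow> 'o \<Rightarrow> 'm" where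
  "Pr2 B X Y = Pb2 B (bang B X) (bang B Y)"

definition Prd :: "('o, 'm, 'x) lexcat_scheme \<Rightarrow> 'o \<Rightarrow> 'o \<Rightarrow> 'o" where
  "Prd B X Y = Dom B (Pr1 B X Y)"

definition pair :: "('o, 'm, 'x) lexcat_scheme \<Rightarrow> 'm \<Rightarrow> 'm \<Rightarrow> 'm" where
  "pair B a b = lift B (Pr1 B (Cod B a) (Cod B b)) (Pr2 B (Cod B a) (Cod B b)) a b"

definition prod_map :: "('o, 'm, 'x) lexcat_scheme \<Rightarrow> 'm \<Rightarrow> 'm \<Rightarrow> 'm" where
  "prod_map B f g =
    pair B (f \<cdot>\<^bsub>B\<^esub> Pr1 B (Dom B f) (Dom B g)) (g \<cdot>\<^bsub>B\<^esub> Pr2 B (Dom B f) (Dom B g))"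


section \<open>Functors and natural transformations\<close>

record ('o, 'm, 'p, 'n) fctr =
  Fob :: "'o \<Rightarrow> 'p"
  Far :: "'m \<Rightarrow> 'n"

locale is_functor = dom: category B + cod: category B'
  for B :: "('o, 'm, 'x) cat_scheme" and B' :: "('p, 'n, 'y) cat_scheme" +
  fixes G :: "('o, 'm, 'p, 'n) fctr"
  assumes fob: "X \<in> Obj B \<Longrightarrow> Fob G X \<in> Obj B'"
    and far: "f \<in> Hom B X Y \<Longrightarrow> Far G f \<in> Hom B' (Fob G X) (Fob G Y)"
    and far_id: "X \<in> Obj B \<Longrightarrow> Far G (Id B X) = Id B' (Fob G X)"
    and far_comp: "\<lbrakk>f \<in> Hom B X Y; g \<in> Hom B Y Z\<rbrakk>
      \<Longrightarrow> Far G (g \<cdot>\<^bsub>B\<^esub> f) = Far G g \<cdot>\<^bsub>B'\<^esub> Far G f"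

definition fctr_comp ::
  "('p, 'n, 'q, 'k) fctr \<Rightarrow> ('o, 'm, 'p, 'n) fctr \<Rightarrow> ('o, 'm, 'q, 'k) fctr" where
  "fctr_comp G F = \<lparr>Fob = (\<lambda>X. Fob G (Fob F X)), Far = (\<lambda>f. Far G (Far F f))\<rparr>"

locale nat_trans = S: is_functor B B' S + T: is_functor B B' T
  for B :: "('o, 'm, 'x) cat_scheme" and B' :: "('p, 'n, 'y) cat_scheme"
    and S T :: "('o, 'm, 'p, 'n) fctr" +
  fixes \<delta> :: "'o \<Rightarrow> 'n"
  assumes component: "X \<in> Obj B \<Longrightarrow> \<delta> X \<in> Hom B' (Fob S X) (Fob T X)"
    and natural: "f \<in> Hom B X Y \<Longrightarrow> \<delta> Y \<cdot>\<^bsub>B'\<^esub> Far S f = Far T f \<cdot>\<^bsub>B'\<^esub> \<delta> X"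

text \<open>
  Preserving the chosen projections strictly entails preserving the chosen pullback objects
  and the mediating morphisms.
\<close>

locale strict_lex_functor = is_functor B B' G + dom: lex_category B + cod: lex_category B'
  for B :: "('o, 'm, 'x) lexcat_scheme" and B' :: "('p, 'n, 'y) lexcat_scheme"
    and G :: "('o, 'm, 'p, 'n) fctr" +
  assumes strict_one: "Fob G (One B) = One B'"
    and strict_pb: "\<lbrakk>f \<in> Arr B; g \<in> Arr B; Cod B f = Cod B g\<rbrakk>
      \<Longrightarrow> Far G (Pb1 B f g) = Pb1 B' (Far G f) (Far G g) \<and>
          Far G (Pb2 B f g) = Pb2 B' (Far G f) (Far G g)"

text \<open>
  The canonical isomorphisms \<open>1 \<cong> G 1\<close> and \<open>G X \<times> G Y \<cong> G (X \<times> Y)\<close>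
  for a functor \<open>G\<close> that preserves finite limits, not necessarily strictly.
\<close>

definition one_iso ::
  "('o, 'm, 'x) lexcat_scheme \<Rightarrow> ('p, 'n, 'y) lexcat_scheme \<Rightarrow> ('o, 'm, 'p, 'n) fctr \<Rightarrow> 'n" where
  "one_iso B B' G = (THE u. u \<in> Hom B' (One B') (Fob G (One B)) \<and> is_iso B' u)"

definition prod_iso ::
  "('o, 'm, 'x) lexcat_scheme \<Rightarrow> ('p, 'n, 'y) lexcat_scheme \<Rightarrow> ('o, 'm, 'p, 'n) fctr
    \<Rightarrow> 'o \<Rightarrow> 'o \<Rightarrow> 'n" where
  "prod_iso B B' G X Y =
    (THE k. k \<in> Hom B' (Prd B' (Fob G X) (Fob G Y)) (Fob G (Prd B X Y)) \<and> is_iso B' k \<and>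
      Far G (Pr1 B X Y) \<cdot>\<^bsub>B'\<^esub> k = Pr1 B' (Fob G X) (Fob G Y) \<and>
      Far G (Pr2 B X Y) \<cdot>\<^bsub>B'\<^esub> k = Pr2 B' (Fob G X) (Fob G Y))"


section \<open>Internal categories with chosen finite limits\<close>

text \<open>
  \<open>iob\<close> and \<open>iar\<close> are the objects of objects and of morphisms. The object of composable pairs
  is given by its two projections \<open>icp1\<close>, \<open>icp2\<close>, which are required to form a pullback of
  \<open>icod\<close> and \<open>idom\<close>, but not the one chosen in the ambient category. This lets a functor that
  preserves pullbacks only up to isomorphism be applied to the data as they stand.
\<close>

record ('o, 'm) icat =
  iob :: 'o
  iar :: 'o
  idom :: 'm
  icod :: 'm
  iid :: 'm
  icp1 :: 'm
  icp2 :: 'm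
  icmp :: 'm

text \<open>
  Internal composition, in diagrammatic order, of generalised morphisms \<open>x\<close>, \<open>y\<close>, that is,
  of morphisms of the ambient category into \<open>iar\<close> with \<open>icod \<cdot> x = idom \<cdot> y\<close>.
\<close>

definition icomp :: "('o, 'm, 'x) cat_scheme \<Rightarrow> ('o, 'm, 'y) icat_scheme \<Rightarrow> 'm \<Rightarrow> 'm \<Rightarrow> 'm" where
  "icomp B C x y = icmp C \<cdot>\<^bsub>B\<^esub> lift B (icp1 C) (icp2 C) x y"

locale internal_category = lex_category B
  for B :: "('o, 'm, 'x) lexcat_scheme" (structure) +
  fixes C :: "('o, 'm, 'y) icat_scheme"
  assumes iob_obj: "iob C \<in> Obj B"
    and iar_obj: "iar C \<in> Obj B"
    and idom_hom: "idom C \<in> Hom B (iar C) (iob C)"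
    and icod_hom: "icod C \<in> Hom B (iar C) (iob C)"
    and iid_hom: "iid C \<in> Hom B (iob C) (iar C)"
    and icp_pullback: "is_pullback B (icod C) (idom C) (icp1 C) (icp2 C)"
    and icmp_hom: "icmp C \<in> Hom B (Dom B (icp1 C)) (iar C)"
    and idom_iid: "idom C \<cdot> iid C = Id B (iob C)"
    and icod_iid: "icod C \<cdot> iid C = Id B (iob C)"
    and idom_icmp: "idom C \<cdot> icmp C = idom C \<cdot> icp1 C"
    and icod_icmp: "icod C \<cdot> icmp C = icod C \<cdot> icp2 C"
    and iunit_left: "icomp B C (iid C \<cdot> idom C) (Id B (iar C)) = Id B (iar C)"
    and iunit_right: "icomp B C (Id B (iar C)) (iid C \<cdot> icod C) = Id B (iar C)"
    and iassoc: "\<lbrakk>x \<in> Hom B X (iar C); y \<in> Hom B X (iar C); z \<in> Hom B X (iar C);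
        icod C \<cdot> x = idom C \<cdot> y; icod C \<cdot> y = idom C \<cdot> z\<rbrakk>
      \<Longrightarrow> icomp B C (icomp B C x y) z = icomp B C x (icomp B C y z)"

text \<open>
  Chosen finite limits in an internal category:
  \<^item> \<open>itrm\<close> is the terminal global object and \<open>ibang\<close> the family of morphisms into it.
  \<^item> \<open>ics1\<close>, \<open>ics2\<close> are the projections from the object of cospans, and \<open>ipb1\<close>, \<open>ipb2\<close> assign to
    a cospan the two legs of its chosen pullback.
  \<^item> \<open>isq1\<close>, \<open>isq2\<close> are the projections from the object of commutative squares
    \<open>(a, f), (b, g)\<close> (composable pairs with equal composite) to the object of composable pairs,
    and \<open>imed\<close> assigns to such a square the mediating morphism into the chosen pullback of
    \<open>f\<close>, \<open>g\<close>.
\<close>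

record ('o, 'm) ilexcat = "('o, 'm) icat" +
  itrm :: 'm
  ibang :: 'm
  ics1 :: 'm
  ics2 :: 'm
  ipb1 :: 'm
  ipb2 :: 'm
  isq1 :: 'm
  isq2 :: 'm
  imed :: 'm

definition icospan :: "('o, 'm, 'x) cat_scheme \<Rightarrow> ('o, 'm, 'y) ilexcat_scheme \<Rightarrow> 'm \<Rightarrow> 'm \<Rightarrow> 'm" where
  "icospan B C f g = lift B (ics1 C) (ics2 C) f g"

definition imediate ::
  "('o, 'm, 'x) cat_scheme \<Rightarrow> ('o, 'm, 'y) ilexcat_scheme \<Rightarrow> 'm \<Rightarrow> 'm \<Rightarrow> 'm \<Rightarrow> 'm \<Rightarrow> 'm" where
  "imediate B C f g a b =
    imed C \<cdot>\<^bsub>B\<^esub> lift B (isq1 C) (isq2 C)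
      (lift B (icp1 C) (icp2 C) a f) (lift B (icp1 C) (icp2 C) b g)"

locale internal_lex_category = internal_category B C
  for B :: "('o, 'm, 'x) lexcat_scheme" (structure) and C :: "('o, 'm, 'y) ilexcat_scheme" +
  assumes itrm_hom: "itrm C \<in> Hom B (One B) (iob C)"
    and ibang_hom: "ibang C \<in> Hom B (iob C) (iar C)"
    and idom_ibang: "idom C \<cdot> ibang C = Id B (iob C)"
    and icod_ibang: "icod C \<cdot> ibang C = itrm C \<cdot> bang B (iob C)"
    and ibang_unique: "\<lbrakk>x \<in> Hom B X (iar C); icod C \<cdot> x = itrm C \<cdot> bang B X\<rbrakk>
      \<Longrightarrow> x = ibang C \<cdot> (idom C \<cdot> x)"
    and ics_pullback: "is_pullback B (icod C) (icod C) (ics1 C) (ics2 C)"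
    and ipb1_hom: "ipb1 C \<in> Hom B (Dom B (ics1 C)) (iar C)"
    and ipb2_hom: "ipb2 C \<in> Hom B (Dom B (ics1 C)) (iar C)"
    and idom_ipb: "idom C \<cdot> ipb1 C = idom C \<cdot> ipb2 C"
    and icod_ipb1: "icod C \<cdot> ipb1 C = idom C \<cdot> ics1 C"
    and icod_ipb2: "icod C \<cdot> ipb2 C = idom C \<cdot> ics2 C"
    and ipb_square: "icomp B C (ipb1 C) (ics1 C) = icomp B C (ipb2 C) (ics2 C)"
    and isq_pullback: "is_pullback B (icmp C) (icmp C) (isq1 C) (isq2 C)"
    and imed_hom: "imed C \<in> Hom B (Dom B (isq1 C)) (iar C)"
    and imediate:
      "\<lbrakk>f \<in> Hom B X (iar C); g \<in> Hom B X (iar C); a \<in> Hom B X (iar C); b \<in> Hom B X (iar C);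
        icod C \<cdot> a = idom C \<cdot> f; icod C \<cdot> b = idom C \<cdot> g; icomp B C a f = icomp B C b g;
        h = imediate B C f g a b; p = ipb1 C \<cdot> icospan B C f g; q = ipb2 C \<cdot> icospan B C f g\<rbrakk>
      \<Longrightarrow> idom C \<cdot> h = idom C \<cdot> a \<and> icod C \<cdot> h = idom C \<cdot> p \<and>
          icomp B C h p = a \<and> icomp B C h q = b"
    and imediate_unique:
      "\<lbrakk>f \<in> Hom B X (iar C); g \<in> Hom B X (iar C); icod C \<cdot> f = icod C \<cdot> g;
        p = ipb1 C \<cdot> icospan B C f g; q = ipb2 C \<cdot> icospan B C f g;
        h \<in> Hom B X (iar C); icod C \<cdot> h = idom C \<cdot> p\<rbrakk>
      \<Longrightarrow> h = imediate B C f g (icomp B C h p) (icomp B C h q)"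


section \<open>Internal functors\<close>

record 'm ifun =
  Hob :: 'm
  Har :: 'm

locale internal_functor = dom: internal_category B C + cod: internal_category B D
  for B :: "('o, 'm, 'x) lexcat_scheme" (structure)
    and C :: "('o, 'm, 'y) icat_scheme" and D :: "('o, 'm, 'z) icat_scheme" +
  fixes H :: "'m ifun"
  assumes hob: "Hob H \<in> Hom B (iob C) (iob D)"
    and har: "Har H \<in> Hom B (iar C) (iar D)"
    and har_idom: "idom D \<cdot> Har H = Hob H \<cdot> idom C"
    and har_icod: "icod D \<cdot> Har H = Hob H \<cdot> icod C"
    and har_iid: "Har H \<cdot> iid C = iid D \<cdot> Hob H"
    and har_icmp: "Har H \<cdot> icmp C = icomp B D (Har H \<cdot> icp1 C) (Har H \<cdot> icp2 C)"

locale strict_lex_internal_functor = internal_functor B C D H +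
  dom: internal_lex_category B C + cod: internal_lex_category B D
  for B :: "('o, 'm, 'x) lexcat_scheme" (structure)
    and C :: "('o, 'm, 'y) ilexcat_scheme" and D :: "('o, 'm, 'z) ilexcat_scheme"
    and H :: "'m ifun" +
  assumes har_itrm: "Hob H \<cdot> itrm C = itrm D"
    and har_ipb1: "Har H \<cdot> ipb1 C = ipb1 D \<cdot> icospan B D (Har H \<cdot> ics1 C) (Har H \<cdot> ics2 C)"
    and har_ipb2: "Har H \<cdot> ipb2 C = ipb2 D \<cdot> icospan B D (Har H \<cdot> ics1 C) (Har H \<cdot> ics2 C)"

definition ifcomp :: "('o, 'm, 'x) cat_scheme \<Rightarrow> 'm ifun \<Rightarrow> 'm ifun \<Rightarrow> 'm ifun" where
  "ifcomp B K H = \<lparr>Hob = Hob K \<cdot>\<^bsub>B\<^esub> Hob H, Har = Har K \<cdot>\<^bsub>B\<^esub> Har H\<rparr>"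


section \<open>Hom-objects, underlying category and global sections\<close>

text \<open>
  \<open>ihom_incl B C X Y\<close> is the projection to \<open>iar C\<close> of the chosen pullback defining the
  hom-object \<open>C(X, Y)\<close>.
\<close>

definition ihom_incl ::
  "('o, 'm, 'x) lexcat_scheme \<Rightarrow> ('o, 'm, 'y) icat_scheme \<Rightarrow> 'm \<Rightarrow> 'm \<Rightarrow> 'm" where
  "ihom_incl B C X Y = Pb1 B (pair B (idom C) (icod C)) (pair B X Y)"

definition ihom ::
  "('o, 'm, 'x) lexcat_scheme \<Rightarrow> ('o, 'm, 'y) icat_scheme \<Rightarrow> 'm \<Rightarrow> 'm \<Rightarrow> 'o" where
  "ihom B C X Y = Dom B (ihom_incl B C X Y)"

text \<open>The morphism into \<open>C(X, Y)\<close> given by a generalised morphism \<open>x\<close> from \<open>X\<close> to \<open>Y\<close>.\<close>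

definition ihom_lift ::
  "('o, 'm, 'x) lexcat_scheme \<Rightarrow> ('o, 'm, 'y) icat_scheme \<Rightarrow> 'm \<Rightarrow> 'm \<Rightarrow> 'm \<Rightarrow> 'm" where
  "ihom_lift B C X Y x =
    lift B (ihom_incl B C X Y) (Pb2 B (pair B (idom C) (icod C)) (pair B X Y))
      x (bang B (Dom B x))"

definition ifun_hom ::
  "('o, 'm, 'x) lexcat_scheme \<Rightarrow> ('o, 'm, 'y) icat_scheme \<Rightarrow> ('o, 'm, 'z) icat_scheme
    \<Rightarrow> 'm ifun \<Rightarrow> 'm \<Rightarrow> 'm \<Rightarrow> 'm" where
  "ifun_hom B C D H X Y =
    ihom_lift B D (Hob H \<cdot>\<^bsub>B\<^esub> X) (Hob H \<cdot>\<^bsub>B\<^esub> Y) (Har H \<cdot>\<^bsub>B\<^esub> ihom_incl B C X Y)"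

text \<open>
  A morphism \<open>1 \<rightarrow> C(X, Y)\<close> is represented by the corresponding morphism \<open>1 \<rightarrow> iar C\<close>.
\<close>

definition Gamma ::
  "('o, 'm, 'x) lexcat_scheme \<Rightarrow> ('o, 'm, 'y) ilexcat_scheme \<Rightarrow> ('m, 'm) lexcat" where
  "Gamma B C = \<lparr>
    Obj = Hom B (One B) (iob C),
    Arr = Hom B (One B) (iar C),
    Dom = (\<lambda>x. idom C \<cdot>\<^bsub>B\<^esub> x),
    Cod = (\<lambda>x. icod C \<cdot>\<^bsub>B\<^esub> x),
    Id = (\<lambda>X. iid C \<cdot>\<^bsub>B\<^esub> X),
    Comp = (\<lambda>y x. icomp B C x y),
    One = itrm C,
    Pb1 = (\<lambda>f g. ipb1 C \<cdot>\<^bsub>B\<^esub> icospan B C f g),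
    Pb2 = (\<lambda>f g. ipb2 C \<cdot>\<^bsub>B\<^esub> icospan B C f g)\<rparr>"

text \<open>
  The functor \<open>C(1, -)\<close>: a global morphism \<open>y\<close> from \<open>X\<close> to \<open>Y\<close> acts by composing the generic
  element of \<open>C(1, X)\<close> with \<open>y\<close>.
\<close>

definition gsec ::
  "('o, 'm, 'x) lexcat_scheme \<Rightarrow> ('o, 'm, 'y) ilexcat_scheme \<Rightarrow> ('m, 'm, 'o, 'm) fctr" where
  "gsec B C = \<lparr>
    Fob = (\<lambda>X. ihom B C (itrm C) X),
    Far = (\<lambda>y. ihom_lift B C (itrm C) (icod C \<cdot>\<^bsub>B\<^esub> y)
      (icomp B C (ihom_incl B C (itrm C) (idom C \<cdot>\<^bsub>B\<^esub> y))
        (y \<cdot>\<^bsub>B\<^esub> bang B (ihom B C (itrm C) (idom C \<cdot>\<^bsub>B\<^esub> y)))))\<rparr>"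


section \<open>Applying a finite-limit-preserving functor to internal data\<close>

definition sharp ::
  "('o, 'm, 'x) lexcat_scheme \<Rightarrow> ('p, 'n, 'y) lexcat_scheme \<Rightarrow> ('o, 'm, 'p, 'n) fctr
    \<Rightarrow> 'm \<Rightarrow> 'n" where
  "sharp B B' G x = Far G x \<cdot>\<^bsub>B'\<^esub> one_iso B B' G"

definition app_icat ::
  "('o, 'm, 'x) lexcat_scheme \<Rightarrow> ('p, 'n, 'y) lexcat_scheme \<Rightarrow> ('o, 'm, 'p, 'n) fctr
    \<Rightarrow> ('o, 'm) ilexcat \<Rightarrow> ('p, 'n) ilexcat" where
  "app_icat B B' G C = \<lparr>
    iob = Fob G (iob C),
    iar = Fob G (iar C),
    idom = Far G (idom C),
    icod = Far G (icod C),
    iid = Far G (iid C),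
    icp1 = Far G (icp1 C),
    icp2 = Far G (icp2 C),
    icmp = Far G (icmp C),
    itrm = sharp B B' G (itrm C),
    ibang = Far G (ibang C),
    ics1 = Far G (ics1 C),
    ics2 = Far G (ics2 C),
    ipb1 = Far G (ipb1 C),
    ipb2 = Far G (ipb2 C),
    isq1 = Far G (isq1 C),
    isq2 = Far G (isq2 C),
    imed = Far G (imed C)\<rparr>"

definition app_ifun :: "('o, 'm, 'p, 'n) fctr \<Rightarrow> 'm ifun \<Rightarrow> 'n ifun" where
  "app_ifun G H = \<lparr>Hob = Far G (Hob H), Har = Far G (Har H)\<rparr>"

text \<open>
  The canonical isomorphism \<open>(G C)(G\<^sup># X, G\<^sup># Y) \<cong> G (C(X, Y))\<close>, characterised by
  compatibility with the monomorphisms of both sides into \<open>G (iar C)\<close>.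
\<close>

definition ihom_iso ::
  "('o, 'm, 'x) lexcat_scheme \<Rightarrow> ('p, 'n, 'y) lexcat_scheme \<Rightarrow> ('o, 'm, 'p, 'n) fctr
    \<Rightarrow> ('o, 'm) ilexcat \<Rightarrow> 'm \<Rightarrow> 'm \<Rightarrow> 'n" where
  "ihom_iso B B' G C X Y =
    (THE k. k \<in> Hom B' (ihom B' (app_icat B B' G C) (sharp B B' G X) (sharp B B' G Y))
                       (Fob G (ihom B C X Y)) \<and>
      is_iso B' k \<and>
      Far G (ihom_incl B C X Y) \<cdot>\<^bsub>B'\<^esub> k =
        ihom_incl B' (app_icat B B' G C) (sharp B B' G X) (sharp B B' G Y))"


section \<open>Geminal categories\<close>

definition Box ::
  "('o, 'm) lexcat \<Rightarrow> ('o, 'm) ilexcat \<Rightarrow> ('o, 'm, 'm, 'm) fctr \<Rightarrow> ('o, 'm, 'o, 'm) fctr" where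
  "Box B C F = fctr_comp (gsec B C) F"

definition BoxC ::
  "('o, 'm) lexcat \<Rightarrow> ('o, 'm) ilexcat \<Rightarrow> ('o, 'm, 'm, 'm) fctr \<Rightarrow> ('o, 'm) ilexcat" where
  "BoxC B C F = app_icat B B (Box B C F) C"

text \<open>
  The conditions \<open>h_fob\<close> and \<open>h_far\<close> are the equation of functors \<open>\<Gamma>H \<circ> F = F\<^sup># \<circ> F\<close> after
  \<open>\<Gamma>(F C)\<close> has been identified with \<open>\<Gamma>(\<box>C)\<close>.
\<close>

locale pre_geminal_category =
  lex_category B + internal_lex_category B C + strict_lex_functor B "Gamma B C" F +
  internal_functor B C "BoxC B C F" H
  for B :: "('o, 'm) lexcat" (structure) and C :: "('o, 'm) ilexcat"
    and F :: "('o, 'm, 'm, 'm) fctr" and H :: "'m ifun" +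
  assumes h_fob: "X \<in> Obj B \<Longrightarrow> Hob H \<cdot> Fob F X = sharp B B (Box B C F) (Fob F X)"
    and h_far: "f \<in> Arr B \<Longrightarrow> Har H \<cdot> Far F f = sharp B B (Box B C F) (Far F f)"

text \<open>
  The codomain of \<open>ifun_hom\<close> below is \<open>(\<box>C)(H 1, H (F A))\<close>, which is the domain
  \<open>(\<box>C)(\<box>\<^sup># 1, \<box>\<^sup># (F A))\<close> of \<open>ihom_iso\<close> by \<open>h_fob\<close> and \<open>F 1 = 1\<close>.
\<close>

definition sigma ::
  "('o, 'm) lexcat \<Rightarrow> ('o, 'm) ilexcat \<Rightarrow> ('o, 'm, 'm, 'm) fctr \<Rightarrow> 'm ifun \<Rightarrow> 'o \<Rightarrow> 'm" where
  "sigma B C F H A =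
    ihom_iso B B (Box B C F) C (itrm C) (Fob F A) \<cdot>\<^bsub>B\<^esub>
      ifun_hom B C (BoxC B C F) H (itrm C) (Fob F A)"

definition Hsharp ::
  "('o, 'm) lexcat \<Rightarrow> ('o, 'm) ilexcat \<Rightarrow> ('o, 'm, 'm, 'm) fctr \<Rightarrow> 'm ifun \<Rightarrow> 'm ifun" where
  "Hsharp B C F H = \<lparr>Hob = sigma B C F H (iob C), Har = sigma B C F H (iar C)\<rparr>"

locale geminal_category =
  pre_geminal_category B C F H + strict_lex_internal_functor B C "BoxC B C F" H
  for B :: "('o, 'm) lexcat" (structure) and C :: "('o, 'm) ilexcat"
    and F :: "('o, 'm, 'm, 'm) fctr" and H :: "'m ifun" +
  assumes h_coassoc: "ifcomp B (app_ifun (Box B C F) H) H = ifcomp B (Hsharp B C F H) H"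

end

theory Submission
  imports Defs
begin

text \<open>
  The coalgebra structure \<open>\<delta>\<close> is \<open>\<sigma>\<close>, determined by \<open>\<box>\<iota>\<^sub>A \<cdot> \<delta>\<^sub>A = H \<cdot> \<iota>\<^sub>A\<close> for the
  monomorphism \<open>\<iota>\<^sub>A\<close> of \<open>\<box>A = C(1, FA)\<close> into the object of arrows. The operator \<open>\<dagger>\<close> comes from an
  internal form of Loeb's argument. An arrow \<open>x\<close> of \<open>C\<close> with codomain \<open>F(iar C)\<close> is a predicate on
  codes of arrows, and its pullback along its own code \<open>H x : 1 \<rightarrow> F(iar C)\<close> is an object \<open>W x\<close> of \<open>C\<close>.
  Diagonalising the family of all arrows \<open>W x \<rightarrow> FA\<close> yields an object \<open>K\<close> of \<open>B\<close> with
  \<open>K \<cong> C(FK, FA)\<close>; here the strictness of \<open>F\<close> and of the equation \<open>\<Gamma>H \<circ> F = F\<^sup># \<circ> F\<close> enters.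
  Then \<open>H\<close> makes \<open>K\<close> a \<open>\<box>\<close>-coalgebra \<open>c : K \<rightarrow> \<box>K\<close>, and \<open>d k = k \<circ> c k\<close> is a coalgebra morphism
  \<open>K \<rightarrow> \<box>A\<close>. Sending \<open>g : F\<box>A \<rightarrow> FA\<close> to \<open>d (g \<circ> Fd)\<close> gives \<open>y : C(F\<box>A, FA) \<rightarrow> \<box>A\<close> with
  \<open>y g = g \<circ> \<delta> (y g)\<close>, and \<open>f\<^sup>\<dagger> b = y (Ff \<langle>b, -\<rangle>)\<close>, which makes naturality in the parameter evident.
\<close>

section \<open>Categories with chosen finite limits\<close>

context category
begin

lemma id_arr [simp]: "X \<in> Obj B \<Longrightarrow> Id B X \<in> Arr B"
  and dom_id [simp]: "X \<in> Obj B \<Longrightarrow> Dom B (Id B X) = X"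
  and cod_id [simp]: "X \<in> Obj B \<Longrightarrow> Cod B (Id B X) = X"
  using id_hom[of X] by (auto simp: Hom_def)

lemma hom_objs: "f \<in> Hom B X Y \<Longrightarrow> X \<in> Obj B \<and> Y \<in> Obj B"
  using dom_obj cod_obj by (auto simp: Hom_def)

text \<open>Associativity carries typing premises and is not a simp rule; this transports a
  commuting square along a generalised element \<open>k\<close> in one step.\<close>

lemma reassoc:
  "\<lbrakk>g \<cdot> f = g' \<cdot> f'; f \<in> Hom B X Y; g \<in> Hom B Y Z; f' \<in> Hom B X Y'; g' \<in> Hom B Y' Z; k \<in> Hom B W X\<rbrakk>
    \<Longrightarrow> g \<cdot> (f \<cdot> k) = g' \<cdot> (f' \<cdot> k)"
  using comp_assoc[of k W X f Y g Z] comp_assoc[of k W X f' Y' g' Z] by simp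

lemma is_pullbackD:
  assumes "is_pullback B f g p q"
  shows "p \<in> Hom B (Dom B p) (Dom B f)" "q \<in> Hom B (Dom B p) (Dom B g)" "f \<cdot> p = g \<cdot> q"
    "f \<in> Hom B (Dom B f) (Cod B f)" "g \<in> Hom B (Dom B g) (Cod B f)"
  using assms by (auto simp: is_pullback_def Hom_def)

lemma is_pullbackI:
  assumes h: "f \<in> Hom B X W" "g \<in> Hom B Y W" "p \<in> Hom B P X" "q \<in> Hom B P Y" "f \<cdot> p = g \<cdot> q"
    and ex1: "\<And>Z a b. \<lbrakk>a \<in> Hom B Z X; b \<in> Hom B Z Y; f \<cdot> a = g \<cdot> b\<rbrakk>
      \<Longrightarrow> \<exists>!h. h \<in> Hom B Z P \<and> p \<cdot> h = a \<and> q \<cdot> h = b"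
  shows "is_pullback B f g p q"
proof -
  have d: "f \<in> Arr B" "g \<in> Arr B" "p \<in> Arr B" "q \<in> Arr B" "Dom B f = X" "Dom B g = Y"
    "Dom B p = P" "Dom B q = P" "Cod B f = W" "Cod B g = W" "Cod B p = X" "Cod B q = Y"
    using h by (simp_all add: Hom_def)
  show ?thesis
    unfolding is_pullback_def d by (intro conjI ballI impI d refl h(5) ex1)
qed

lemma lift_props:
  assumes pb: "is_pullback B f g p q" and a: "a \<in> Hom B X (Dom B f)" and b: "b \<in> Hom B X (Dom B g)"
    and eq: "f \<cdot> a = g \<cdot> b"
  shows lift_hom: "lift B p q a b \<in> Hom B X (Dom B p)"
    and "p \<cdot> lift B p q a b = a"
    and "q \<cdot> lift B p q a b = b"
proof -
  have X: "X \<in> Obj B" "Dom B a = X" using a hom_objs by (auto simp: Hom_def)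
  then have "\<exists>!h. h \<in> Hom B (Dom B a) (Dom B p) \<and> p \<cdot> h = a \<and> q \<cdot> h = b"
    using pb a b eq unfolding is_pullback_def by blast
  from theI'[OF this] X show "lift B p q a b \<in> Hom B X (Dom B p)" "p \<cdot> lift B p q a b = a"
    "q \<cdot> lift B p q a b = b"
    by (auto simp: lift_def)
qed

lemma pullback_unique:
  assumes pb: "is_pullback B f g p q" and h: "h \<in> Hom B X (Dom B p)" and k: "k \<in> Hom B X (Dom B p)"
    and 1: "p \<cdot> h = p \<cdot> k" and 2: "q \<cdot> h = q \<cdot> k"
  shows "h = k"
proof -
  note D = is_pullbackD[OF pb]
  have X: "X \<in> Obj B" using hom_objs[OF h] by simp
  have a: "p \<cdot> h \<in> Hom B X (Dom B f)" using comp_hom[OF h D(1)] .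
  have b: "q \<cdot> h \<in> Hom B X (Dom B g)" using comp_hom[OF h D(2)] .
  have "f \<cdot> (p \<cdot> h) = g \<cdot> (q \<cdot> h)"
    using reassoc[OF D(3) D(1) D(4) D(2) D(5) h] .
  then have "\<exists>!x. x \<in> Hom B X (Dom B p) \<and> p \<cdot> x = p \<cdot> h \<and> q \<cdot> x = q \<cdot> h"
    using pb X a b unfolding is_pullback_def by blast
  then show ?thesis using h k 1 2 by metis
qed

text \<open>Change of stage: both sides have the same projections. Stability of internal composition
  and of internal pullbacks under precomposition rests on this.\<close>

lemma lift_comp:
  assumes pb: "is_pullback B f g p q" and a: "a \<in> Hom B X (Dom B f)" and b: "b \<in> Hom B X (Dom B g)"
    and eq: "f \<cdot> a = g \<cdot> b" and k: "k \<in> Hom B W X"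
  shows "lift B p q a b \<cdot> k = lift B p q (a \<cdot> k) (b \<cdot> k)"
proof (rule pullback_unique[OF pb])
  note D = is_pullbackD[OF pb] and L = lift_props[OF pb a b eq]
  have ak: "a \<cdot> k \<in> Hom B W (Dom B f)" and bk: "b \<cdot> k \<in> Hom B W (Dom B g)"
    using comp_hom[OF k] a b by auto
  have eqk: "f \<cdot> (a \<cdot> k) = g \<cdot> (b \<cdot> k)" using reassoc[OF eq a D(4) b D(5) k] .
  note Lk = lift_props[OF pb ak bk eqk]
  show "lift B p q a b \<cdot> k \<in> Hom B W (Dom B p)" using comp_hom[OF k L(1)] .
  show "lift B p q (a \<cdot> k) (b \<cdot> k) \<in> Hom B W (Dom B p)" using Lk(1) .
  show "p \<cdot> lift B p q a b \<cdot> k = p \<cdot> lift B p q (a \<cdot> k) (b \<cdot> k)"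
    using comp_assoc[OF k L(1) D(1)] L(2) Lk(2) by simp
  show "q \<cdot> lift B p q a b \<cdot> k = q \<cdot> lift B p q (a \<cdot> k) (b \<cdot> k)"
    using comp_assoc[OF k L(1) D(2)] L(3) Lk(3) by simp
qed

end

section \<open>Terminal object and binary products\<close>

context lex_category
begin

lemma one_obj [simp]: "One B \<in> Obj B"
  using one_terminal by (simp add: is_terminal_def)

lemma bang_hom: "X \<in> Obj B \<Longrightarrow> bang B X \<in> Hom B X (One B)"
  using one_terminal theI'[of "\<lambda>h. h \<in> Hom B X (One B)"] by (auto simp: is_terminal_def bang_def)

lemma bang_arr [simp]: "X \<in> Obj B \<Longrightarrow> bang B X \<in> Arr B"
  and dom_bang [simp]: "X \<in> Obj B \<Longrightarrow> Dom B (bang B X) = X"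
  and cod_bang [simp]: "X \<in> Obj B \<Longrightarrow> Cod B (bang B X) = One B"
  using bang_hom[of X] by (auto simp: Hom_def)

lemma to_one_unique: "\<lbrakk>f \<in> Hom B X (One B); g \<in> Hom B X (One B)\<rbrakk> \<Longrightarrow> f = g"
  using one_terminal hom_objs by (auto simp: is_terminal_def)

lemma bang_eq: "f \<in> Hom B X (One B) \<Longrightarrow> f = bang B X"
  using to_one_unique bang_hom hom_objs by blast

lemma bang_one [simp]: "bang B (One B) = Id B (One B)"
  using bang_eq[OF id_hom[OF one_obj]] by simp

lemma prod_pullback:
  "\<lbrakk>X \<in> Obj B; Y \<in> Obj B\<rbrakk> \<Longrightarrow> is_pullback B (bang B X) (bang B Y) (Pr1 B X Y) (Pr2 B X Y)"
  unfolding Pr1_def Pr2_def by (rule pb_pullback) auto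

lemma pr_hom:
  assumes "X \<in> Obj B" "Y \<in> Obj B"
  shows pr1_hom: "Pr1 B X Y \<in> Hom B (Prd B X Y) X" and pr2_hom: "Pr2 B X Y \<in> Hom B (Prd B X Y) Y"
  using is_pullbackD[OF prod_pullback[OF assms]] assms by (auto simp: Prd_def)

lemma prd_obj: "\<lbrakk>X \<in> Obj B; Y \<in> Obj B\<rbrakk> \<Longrightarrow> Prd B X Y \<in> Obj B"
  using pr1_hom hom_objs by blast

lemma pair_props:
  assumes a: "a \<in> Hom B Z X" and b: "b \<in> Hom B Z Y"
  shows pair_hom: "pair B a b \<in> Hom B Z (Prd B X Y)"
    and "Pr1 B X Y \<cdot> pair B a b = a"
    and "Pr2 B X Y \<cdot> pair B a b = b"
proof -
  have o: "X \<in> Obj B" "Y \<in> Obj B" "Z \<in> Obj B" using hom_objs a b by auto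
  have c: "Cod B a = X" "Cod B b = Y" using a b by (auto simp: Hom_def)
  have "bang B X \<cdot> a = bang B Y \<cdot> b"
    by (rule to_one_unique[OF comp_hom[OF a bang_hom[OF o(1)]] comp_hom[OF b bang_hom[OF o(2)]]])
  note L = lift_props[OF prod_pullback[OF o(1,2)] _ _ this, simplified o dom_bang, OF a b]
  show "pair B a b \<in> Hom B Z (Prd B X Y)" "Pr1 B X Y \<cdot> pair B a b = a" "Pr2 B X Y \<cdot> pair B a b = b"
    using L by (auto simp: pair_def c Prd_def)
qed

lemma prd_unique:
  assumes "h \<in> Hom B Z (Prd B X Y)" "k \<in> Hom B Z (Prd B X Y)" "X \<in> Obj B" "Y \<in> Obj B"
    "Pr1 B X Y \<cdot> h = Pr1 B X Y \<cdot> k" "Pr2 B X Y \<cdot> h = Pr2 B X Y \<cdot> k"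
  shows "h = k"
  using pullback_unique[OF prod_pullback[OF assms(3,4)]] assms by (simp add: Prd_def)

lemma pair_comp:
  assumes X: "X \<in> Hom B Z V" and Y: "Y \<in> Hom B Z U" and k: "k \<in> Hom B W Z"
  shows "pair B X Y \<cdot> k = pair B (X \<cdot> k) (Y \<cdot> k)"
proof -
  have o: "V \<in> Obj B" "U \<in> Obj B" using hom_objs X Y by auto
  note P = pair_props[OF X Y] and Q = pair_props[OF comp_hom[OF k X] comp_hom[OF k Y]]
    and R = pr_hom[OF o]
  show ?thesis
    by (rule prd_unique[OF comp_hom[OF k P(1)] Q(1) o])
      (use comp_assoc[OF k P(1) R(1)] comp_assoc[OF k P(1) R(2)] P Q in auto)
qed

end

section \<open>Generalised elements of internal categories\<close>

text \<open>Generalised arrows of \<open>C\<close> at stage \<open>Z\<close>: families indexed by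
  \<open>Z\<close>, with families of objects \<open>X\<close>, \<open>Y\<close> as ends. Internal
  equations are proved for such families as in an ordinary category, and change of stage is
  precomposition.\<close>

definition ielem :: "('o, 'm, 'x) cat_scheme \<Rightarrow> ('o, 'm, 'y) icat_scheme \<Rightarrow> 'o \<Rightarrow> 'm \<Rightarrow> 'm \<Rightarrow> 'm set" where
  "ielem B C Z X Y = {x \<in> Hom B Z (iar C). idom C \<cdot>\<^bsub>B\<^esub> x = X \<and> icod C \<cdot>\<^bsub>B\<^esub> x = Y}"

lemma ielemD:
  assumes "x \<in> ielem B C Z X Y"
  shows "x \<in> Hom B Z (iar C)" "idom C \<cdot>\<^bsub>B\<^esub> x = X" "icod C \<cdot>\<^bsub>B\<^esub> x = Y"
  using assms by (auto simp: ielem_def)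

context internal_category
begin

lemma ielem_stage: "\<lbrakk>x \<in> ielem B C Z X Y; k \<in> Hom B W Z\<rbrakk> \<Longrightarrow> x \<cdot> k \<in> ielem B C W (X \<cdot> k) (Y \<cdot> k)"
  using comp_hom comp_assoc[OF _ _ idom_hom] comp_assoc[OF _ _ icod_hom] by (auto simp: ielem_def)

lemma ielem_ends:
  assumes "x \<in> ielem B C Z X Y"
  shows "X \<in> Hom B Z (iob C)" "Y \<in> Hom B Z (iob C)"
  using ielemD[OF assms] comp_hom[OF _ idom_hom] comp_hom[OF _ icod_hom] by auto

lemma icomp_lift_props:
  assumes x: "x \<in> ielem B C Z X Y" and y: "y \<in> ielem B C Z Y W"
  shows "lift B (icp1 C) (icp2 C) x y \<in> Hom B Z (Dom B (icp1 C))"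
    and "icp1 C \<cdot> lift B (icp1 C) (icp2 C) x y = x"
    and "icp2 C \<cdot> lift B (icp1 C) (icp2 C) x y = y"
  using lift_props[OF icp_pullback, of x Z y] ielemD[OF x] ielemD[OF y] icod_hom idom_hom
  by (auto simp: Hom_def)

lemma icp_hom: "icp1 C \<in> Hom B (Dom B (icp1 C)) (iar C)" "icp2 C \<in> Hom B (Dom B (icp1 C)) (iar C)"
  using is_pullbackD[OF icp_pullback] icod_hom idom_hom by (auto simp: Hom_def)

lemma icomp_ielem:
  assumes x: "x \<in> ielem B C Z X Y" and y: "y \<in> ielem B C Z Y W"
  shows "icomp B C x y \<in> ielem B C Z X W"
proof -
  note L = icomp_lift_props[OF x y]
  have "idom C \<cdot> icomp B C x y = X"
    using reassoc[OF idom_icmp icmp_hom idom_hom icp_hom(1) idom_hom L(1)] L(2) ielemD[OF x]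
    by (simp add: icomp_def)
  moreover have "icod C \<cdot> icomp B C x y = W"
    using reassoc[OF icod_icmp icmp_hom icod_hom icp_hom(2) icod_hom L(1)] L(3) ielemD[OF y]
    by (simp add: icomp_def)
  ultimately show ?thesis
    using comp_hom[OF L(1) icmp_hom] by (simp add: ielem_def icomp_def)
qed

lemma icomp_stage:
  assumes x: "x \<in> ielem B C Z X Y" and y: "y \<in> ielem B C Z Y W" and k: "k \<in> Hom B V Z"
  shows "icomp B C x y \<cdot> k = icomp B C (x \<cdot> k) (y \<cdot> k)"
proof -
  have "lift B (icp1 C) (icp2 C) x y \<cdot> k = lift B (icp1 C) (icp2 C) (x \<cdot> k) (y \<cdot> k)"
    by (rule lift_comp[OF icp_pullback _ _ _ k])
      (use ielemD[OF x] ielemD[OF y] icod_hom idom_hom in \<open>auto simp: Hom_def\<close>)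
  then show ?thesis
    unfolding icomp_def using comp_assoc[OF k icomp_lift_props(1)[OF x y] icmp_hom] by simp
qed

lemma icomp_assoc:
  "\<lbrakk>x \<in> ielem B C Z X Y; y \<in> ielem B C Z Y V; z \<in> ielem B C Z V W\<rbrakk>
    \<Longrightarrow> icomp B C (icomp B C x y) z = icomp B C x (icomp B C y z)"
  by (rule iassoc) (auto simp: ielem_def)

lemma iid_ielem:
  assumes "X \<in> Hom B Z (iob C)"
  shows "iid C \<cdot> X \<in> ielem B C Z X X"
  using comp_hom[OF assms iid_hom] comp_assoc[OF assms iid_hom idom_hom]
    comp_assoc[OF assms iid_hom icod_hom] id_left[OF assms]
  by (simp add: ielem_def idom_iid icod_iid)

text \<open>The unit axiom is stated for the generic arrow \<open>Id B (iar C)\<close>; every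
  \<open>x\<close> is the generic arrow restricted along \<open>x\<close> itself, so
  \<open>icomp_stage\<close> gives the general case.\<close>

lemma icomp_iid_left:
  assumes x: "x \<in> ielem B C Z X Y"
  shows "icomp B C (iid C \<cdot> X) x = x"
proof -
  note xD = ielemD[OF x]
  have i: "Id B (iar C) \<in> ielem B C (iar C) (idom C) (icod C)"
    using id_hom[OF iar_obj] id_right[OF idom_hom] id_right[OF icod_hom] by (simp add: ielem_def)
  have "icomp B C (iid C \<cdot> idom C) (Id B (iar C)) \<cdot> x = icomp B C ((iid C \<cdot> idom C) \<cdot> x) (Id B (iar C) \<cdot> x)"
    by (rule icomp_stage[OF iid_ielem[OF idom_hom] i xD(1)])
  then show ?thesis
    using iunit_left id_left[OF xD(1)] comp_assoc[OF xD(1) idom_hom iid_hom] xD(2) by simp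
qed

lemma icomp_iid_right:
  assumes x: "x \<in> ielem B C Z X Y"
  shows "icomp B C x (iid C \<cdot> Y) = x"
proof -
  note xD = ielemD[OF x]
  have i: "Id B (iar C) \<in> ielem B C (iar C) (idom C) (icod C)"
    using id_hom[OF iar_obj] id_right[OF idom_hom] id_right[OF icod_hom] by (simp add: ielem_def)
  have "icomp B C (Id B (iar C)) (iid C \<cdot> icod C) \<cdot> x = icomp B C (Id B (iar C) \<cdot> x) ((iid C \<cdot> icod C) \<cdot> x)"
    by (rule icomp_stage[OF i iid_ielem[OF icod_hom] xD(1)])
  then show ?thesis
    using iunit_right id_left[OF xD(1)] comp_assoc[OF xD(1) icod_hom iid_hom] xD(3) by simp
qed

end

text \<open>
  The universal property of \<open>C(X, Y)\<close>, free of the choice of pullback: functors preserving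
  finite limits preserve it, and it allows a fixed point \<open>K = C(FK, FA)\<close> on the nose.
\<close>

definition hom_object ::
  "('o, 'm, 'x) lexcat_scheme \<Rightarrow> ('o, 'm, 'y) icat_scheme \<Rightarrow> 'o \<Rightarrow> 'm \<Rightarrow> 'm \<Rightarrow> 'm \<Rightarrow> bool" where
  "hom_object B C K X Y p \<longleftrightarrow> p \<in> ielem B C K (X \<cdot>\<^bsub>B\<^esub> bang B K) (Y \<cdot>\<^bsub>B\<^esub> bang B K) \<and>
    (\<forall>Z. \<forall>x \<in> ielem B C Z (X \<cdot>\<^bsub>B\<^esub> bang B Z) (Y \<cdot>\<^bsub>B\<^esub> bang B Z).
      \<exists>!h. h \<in> Hom B Z K \<and> p \<cdot>\<^bsub>B\<^esub> h = x)"

section \<open>Hom-objects: universal property and presentation as pullbacks\<close>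

context internal_category
begin

lemma const_comp:
  assumes X: "X \<in> Hom B (One B) V" and k: "k \<in> Hom B W Z"
  shows "(X \<cdot> bang B Z) \<cdot> k = X \<cdot> bang B W"
proof -
  have b: "bang B Z \<in> Hom B Z (One B)" using bang_hom hom_objs[OF k] by simp
  show ?thesis unfolding comp_assoc[OF k b X] bang_eq[OF comp_hom[OF k b]] ..
qed

lemma hom_objectD:
  assumes "hom_object B C K X Y p"
  shows "p \<in> ielem B C K (X \<cdot> bang B K) (Y \<cdot> bang B K)" "p \<in> Hom B K (iar C)"
proof -
  show 1: "p \<in> ielem B C K (X \<cdot> bang B K) (Y \<cdot> bang B K)"
    using assms unfolding hom_object_def by (rule conjunct1)
  show "p \<in> Hom B K (iar C)" by (rule ielemD(1)[OF 1])
qed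

lemma hom_object_ex1:
  "\<lbrakk>hom_object B C K X Y p; x \<in> ielem B C Z (X \<cdot> bang B Z) (Y \<cdot> bang B Z)\<rbrakk>
    \<Longrightarrow> \<exists>!h. h \<in> Hom B Z K \<and> p \<cdot> h = x"
  unfolding hom_object_def by (drule conjunct2) (drule spec, erule bspec)

lemma hom_object_factor:
  assumes "hom_object B C K X Y p" "x \<in> ielem B C Z (X \<cdot> bang B Z) (Y \<cdot> bang B Z)"
  obtains h where "h \<in> Hom B Z K" "p \<cdot> h = x"
  using ex1_implies_ex[OF hom_object_ex1[OF assms]] by blast

lemma hom_object_elem:
  assumes p: "hom_object B C K X Y p" and X: "X \<in> Hom B (One B) (iob C)" and Y: "Y \<in> Hom B (One B) (iob C)"
    and h: "h \<in> Hom B Z K"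
  shows "p \<cdot> h \<in> ielem B C Z (X \<cdot> bang B Z) (Y \<cdot> bang B Z)"
  using ielem_stage[OF hom_objectD(1)[OF p] h] const_comp[OF X h] const_comp[OF Y h] by simp

lemma hom_object_mono:
  assumes p: "hom_object B C K X Y p" and X: "X \<in> Hom B (One B) (iob C)" and Y: "Y \<in> Hom B (One B) (iob C)"
    and h: "h \<in> Hom B Z K" "k \<in> Hom B Z K" "p \<cdot> h = p \<cdot> k"
  shows "h = k"
  using hom_object_ex1[OF p hom_object_elem[OF p X Y h(1)]] h by metis

text \<open>The projections of \<open>iob C\<close> \<times> \<open>iob C\<close> are jointly monic,
  so one equation of pairs amounts to two conditions on the ends. This links pullback squares over
  the product with \<open>ielem\<close>.\<close>

lemma ends_pair_iff:
  assumes x: "x \<in> Hom B Z (iar C)" and X: "X \<in> Hom B Z (iob C)" and Y: "Y \<in> Hom B Z (iob C)"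
  shows "pair B (idom C) (icod C) \<cdot> x = pair B X Y \<longleftrightarrow> x \<in> ielem B C Z X Y"
proof -
  note P = pair_props[OF idom_hom icod_hom] and Q = pair_props[OF X Y]
    and R = pr_hom[OF iob_obj iob_obj]
  have "Pr1 B (iob C) (iob C) \<cdot> (pair B (idom C) (icod C) \<cdot> x) = idom C \<cdot> x"
    "Pr2 B (iob C) (iob C) \<cdot> (pair B (idom C) (icod C) \<cdot> x) = icod C \<cdot> x"
    using comp_assoc[OF x P(1) R(1)] comp_assoc[OF x P(1) R(2)] P(2,3) by auto
  then show ?thesis
    using prd_unique[OF comp_hom[OF x P(1)] Q(1) iob_obj iob_obj] Q(2,3) x
    by (auto simp: ielem_def)
qed

text \<open>The second leg lands in the terminal object, so it can only be \<open>bang\<close>. In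
  pullback form a hom-object can be transported by a functor that preserves pullbacks.\<close>

lemma hom_object_iff_pullback:
  assumes X: "X \<in> Hom B (One B) (iob C)" and Y: "Y \<in> Hom B (One B) (iob C)"
    and p: "p \<in> Hom B K (iar C)"
  shows "hom_object B C K X Y p \<longleftrightarrow>
    is_pullback B (pair B (idom C) (icod C)) (pair B X Y) p (bang B K)"
proof
  have K: "K \<in> Obj B" using hom_objs[OF p] by simp
  let ?e = "pair B (idom C) (icod C)" and ?g = "pair B X Y"
  have iff: "?e \<cdot> x = ?g \<cdot> bang B Z \<longleftrightarrow> x \<in> ielem B C Z (X \<cdot> bang B Z) (Y \<cdot> bang B Z)"
    if x: "x \<in> Hom B Z (iar C)" for x Z
  proof -
    have b: "bang B Z \<in> Hom B Z (One B)" using bang_hom hom_objs[OF x] by simp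
    show ?thesis
      unfolding pair_comp[OF X Y b] by (rule ends_pair_iff[OF x comp_hom[OF b X] comp_hom[OF b Y]])
  qed
  note E = pair_hom[OF idom_hom icod_hom] and G = pair_hom[OF X Y]
  {
    assume h: "hom_object B C K X Y p"
    show "is_pullback B ?e ?g p (bang B K)"
    proof (rule is_pullbackI[OF E G p bang_hom[OF K]])
      show "?e \<cdot> p = ?g \<cdot> bang B K" using iff[OF p] hom_objectD(1)[OF h] by simp
      fix Z a b assume a: "a \<in> Hom B Z (iar C)" and b: "b \<in> Hom B Z (One B)" and eq: "?e \<cdot> a = ?g \<cdot> b"
      have "a \<in> ielem B C Z (X \<cdot> bang B Z) (Y \<cdot> bang B Z)" using iff[OF a] eq bang_eq[OF b] by simp
      from hom_object_ex1[OF h this]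
      show "\<exists>!k. k \<in> Hom B Z K \<and> p \<cdot> k = a \<and> bang B K \<cdot> k = b"
        using to_one_unique[OF comp_hom[OF _ bang_hom[OF K]] b] by metis
    qed
  next
    assume pb: "is_pullback B ?e ?g p (bang B K)"
    have d: "Dom B ?e = iar C" "Dom B ?g = One B" "Dom B p = K" using E G p by (simp_all add: Hom_def)
    have "p \<in> ielem B C K (X \<cdot> bang B K) (Y \<cdot> bang B K)"
      using is_pullbackD(3)[OF pb] iff[OF p] by simp
    moreover have "\<exists>!h. h \<in> Hom B Z K \<and> p \<cdot> h = x"
      if x: "x \<in> ielem B C Z (X \<cdot> bang B Z) (Y \<cdot> bang B Z)" for Z x
    proof (rule ex_ex1I)
      note xh = ielemD(1)[OF x]
      have b: "bang B Z \<in> Hom B Z (One B)" using bang_hom hom_objs[OF xh] by simp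
      note L = lift_props[OF pb _ _ iff[OF xh, THEN iffD2, OF x], unfolded d, OF xh b]
      show "\<exists>h. h \<in> Hom B Z K \<and> p \<cdot> h = x" using L by blast
      fix h k assume hk: "h \<in> Hom B Z K \<and> p \<cdot> h = x" "k \<in> Hom B Z K \<and> p \<cdot> k = x"
      then have "bang B K \<cdot> h = bang B K \<cdot> k"
        using to_one_unique[OF comp_hom[OF _ bang_hom[OF K]] comp_hom[OF _ bang_hom[OF K]]] by blast
      with hk show "h = k" using pullback_unique[OF pb, unfolded d, of h Z k] by simp
    qed
    ultimately show "hom_object B C K X Y p" unfolding hom_object_def by blast
  }
qed

lemma ihom_object:
  assumes X: "X \<in> Hom B (One B) (iob C)" and Y: "Y \<in> Hom B (One B) (iob C)"
  shows "hom_object B C (ihom B C X Y) X Y (ihom_incl B C X Y)"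
    and "Pb2 B (pair B (idom C) (icod C)) (pair B X Y) = bang B (ihom B C X Y)"
proof -
  have H: "pair B (idom C) (icod C) \<in> Hom B (iar C) (Prd B (iob C) (iob C))"
    "pair B X Y \<in> Hom B (One B) (Prd B (iob C) (iob C))"
    using pair_hom[OF idom_hom icod_hom] pair_hom[OF X Y] by auto
  have pb: "is_pullback B (pair B (idom C) (icod C)) (pair B X Y) (ihom_incl B C X Y)
      (Pb2 B (pair B (idom C) (icod C)) (pair B X Y))"
    unfolding ihom_incl_def by (rule pb_pullback) (use H in \<open>auto simp: Hom_def\<close>)
  show *: "Pb2 B (pair B (idom C) (icod C)) (pair B X Y) = bang B (ihom B C X Y)"
    using is_pullbackD(2)[OF pb] H by (intro bang_eq) (auto simp: Hom_def ihom_def)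
  show "hom_object B C (ihom B C X Y) X Y (ihom_incl B C X Y)"
    using pb is_pullbackD(1)[OF pb] H hom_object_iff_pullback[OF X Y]
    unfolding * by (auto simp: Hom_def ihom_def)
qed

lemma ihom_lift:
  assumes X: "X \<in> Hom B (One B) (iob C)" and Y: "Y \<in> Hom B (One B) (iob C)"
    and x: "x \<in> ielem B C Z (X \<cdot> bang B Z) (Y \<cdot> bang B Z)"
  shows "ihom_lift B C X Y x \<in> Hom B Z (ihom B C X Y)" "ihom_incl B C X Y \<cdot> ihom_lift B C X Y x = x"
proof -
  note O = ihom_object[OF X Y]
  note I = hom_objectD[OF O(1)]
  note pb = hom_object_iff_pullback[OF X Y I(2), THEN iffD1, OF O(1)]
  have Z: "Z \<in> Obj B" and D: "Dom B x = Z" using hom_objs[OF ielemD(1)[OF x]] ielemD(1)[OF x] by (auto simp: Hom_def)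
  have dp: "Dom B (pair B (idom C) (icod C)) = iar C" "Dom B (pair B X Y) = One B" "Dom B (ihom_incl B C X Y) = ihom B C X Y"
    using pair_hom[OF idom_hom icod_hom] pair_hom[OF X Y] I(2) by (auto simp: Hom_def)
  have eq: "pair B (idom C) (icod C) \<cdot> x = pair B X Y \<cdot> bang B Z"
    unfolding pair_comp[OF X Y bang_hom[OF Z]]
    using ends_pair_iff[OF ielemD(1)[OF x] ielem_ends[OF x]] x by simp
  note L = lift_props[OF pb _ _ eq, unfolded dp, OF ielemD(1)[OF x] bang_hom[OF Z]]
  show "ihom_lift B C X Y x \<in> Hom B Z (ihom B C X Y)" "ihom_incl B C X Y \<cdot> ihom_lift B C X Y x = x"
    using L by (auto simp: ihom_lift_def O(2) D)
qed

end

section \<open>Internal functors on generalised arrows\<close>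

context internal_functor
begin

lemma har_ielem:
  assumes x: "x \<in> ielem B C Z X Y"
  shows "Har H \<cdot> x \<in> ielem B D Z (Hob H \<cdot> X) (Hob H \<cdot> Y)"
  using dom.reassoc[OF har_idom har cod.idom_hom dom.idom_hom hob ielemD(1)[OF x]]
    dom.reassoc[OF har_icod har cod.icod_hom dom.icod_hom hob ielemD(1)[OF x]]
    dom.comp_hom[OF ielemD(1)[OF x] har] ielemD(2,3)[OF x]
  by (simp add: ielem_def)

text \<open>Functoriality is assumed for the universal composable pair \<open>icp1\<close>,
  \<open>icp2\<close>; any composable pair is its restriction along a \<open>lift\<close>.\<close>

lemma har_icomp:
  assumes x: "x \<in> ielem B C Z X Y" and y: "y \<in> ielem B C Z Y W"
  shows "Har H \<cdot> icomp B C x y = icomp B D (Har H \<cdot> x) (Har H \<cdot> y)"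
proof -
  note L = dom.icomp_lift_props[OF x y]
  let ?D = "Dom B (icp1 C)"
  have p1: "icp1 C \<in> ielem B C ?D (idom C \<cdot> icp1 C) (icod C \<cdot> icp1 C)"
    and p2: "icp2 C \<in> ielem B C ?D (icod C \<cdot> icp1 C) (icod C \<cdot> icp2 C)"
    using dom.icp_hom dom.is_pullbackD(3)[OF dom.icp_pullback] by (auto simp: ielem_def)
  have "Har H \<cdot> icomp B C x y = (Har H \<cdot> icmp C) \<cdot> lift B (icp1 C) (icp2 C) x y"
    unfolding icomp_def using dom.comp_assoc[OF L(1) dom.icmp_hom har] by simp
  also have "\<dots> = icomp B D ((Har H \<cdot> icp1 C) \<cdot> lift B (icp1 C) (icp2 C) x y)
      ((Har H \<cdot> icp2 C) \<cdot> lift B (icp1 C) (icp2 C) x y)"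
    unfolding har_icmp by (rule cod.icomp_stage[OF har_ielem[OF p1] har_ielem[OF p2] L(1)])
  also have "\<dots> = icomp B D (Har H \<cdot> x) (Har H \<cdot> y)"
    using dom.comp_assoc[OF L(1) dom.icp_hom(1) har] dom.comp_assoc[OF L(1) dom.icp_hom(2) har] L(2,3) by simp
  finally show ?thesis .
qed

end

section \<open>Internal terminal object and internal pullbacks at an arbitrary stage\<close>

context internal_lex_category
begin

lemma ibang_ielem:
  assumes X: "X \<in> Hom B Z (iob C)"
  shows "ibang C \<cdot> X \<in> ielem B C Z X (itrm C \<cdot> bang B Z)"
proof -
  have o: "iob C \<in> Obj B" using hom_objs[OF X] by simp
  have "itrm C \<cdot> bang B (iob C) \<cdot> X = itrm C \<cdot> bang B Z"
    using bang_eq[OF comp_hom[OF X bang_hom[OF o]]] by simp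
  then show ?thesis
    using comp_hom[OF X ibang_hom] id_left[OF X]
      comp_assoc[OF X ibang_hom idom_hom] comp_assoc[OF X ibang_hom icod_hom]
      comp_assoc[OF X bang_hom[OF o] itrm_hom]
    by (simp add: ielem_def idom_ibang icod_ibang)
qed

lemma to_itrm_unique:
  assumes x: "x \<in> ielem B C Z X (itrm C \<cdot> bang B Z)" and y: "y \<in> ielem B C Z X (itrm C \<cdot> bang B Z)"
  shows "x = y"
  using ibang_unique[OF ielemD(1)[OF x] ielemD(3)[OF x]] ibang_unique[OF ielemD(1)[OF y] ielemD(3)[OF y]]
    ielemD(2)[OF x] ielemD(2)[OF y] by simp

abbreviation ileg1 :: "'m \<Rightarrow> 'm \<Rightarrow> 'm" where
  "ileg1 f g \<equiv> ipb1 C \<cdot> icospan B C f g"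

abbreviation ileg2 :: "'m \<Rightarrow> 'm \<Rightarrow> 'm" where
  "ileg2 f g \<equiv> ipb2 C \<cdot> icospan B C f g"

abbreviation iapex :: "'m \<Rightarrow> 'm \<Rightarrow> 'm" where
  "iapex f g \<equiv> idom C \<cdot> ileg1 f g"

lemma icospan_props:
  assumes f: "f \<in> ielem B C Z X V" and g: "g \<in> ielem B C Z Y V"
  shows "icospan B C f g \<in> Hom B Z (Dom B (ics1 C))"
    and "ics1 C \<cdot> icospan B C f g = f"
    and "ics2 C \<cdot> icospan B C f g = g"
  using lift_props[OF ics_pullback, of f Z g] ielemD[OF f] ielemD[OF g] icod_hom
  by (simp_all add: icospan_def Hom_def)

lemma ics_hom: "ics1 C \<in> Hom B (Dom B (ics1 C)) (iar C)" "ics2 C \<in> Hom B (Dom B (ics1 C)) (iar C)"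
  using is_pullbackD(1,2)[OF ics_pullback] icod_hom by (simp_all add: Hom_def)

lemma icospan_stage:
  assumes f: "f \<in> ielem B C Z X V" and g: "g \<in> ielem B C Z Y V" and k: "k \<in> Hom B W Z"
  shows "icospan B C f g \<cdot> k = icospan B C (f \<cdot> k) (g \<cdot> k)"
  unfolding icospan_def
  by (rule lift_comp[OF ics_pullback _ _ _ k]) (use ielemD[OF f] ielemD[OF g] icod_hom in \<open>simp_all add: Hom_def\<close>)

lemma ileg_stage:
  assumes f: "f \<in> ielem B C Z X V" and g: "g \<in> ielem B C Z Y V" and k: "k \<in> Hom B W Z"
  shows "ileg1 f g \<cdot> k = ileg1 (f \<cdot> k) (g \<cdot> k)" "ileg2 f g \<cdot> k = ileg2 (f \<cdot> k) (g \<cdot> k)"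
  using comp_assoc[OF k icospan_props(1)[OF f g] ipb1_hom] comp_assoc[OF k icospan_props(1)[OF f g] ipb2_hom]
    icospan_stage[OF f g k] by simp_all

lemma ileg_ielem:
  assumes f: "f \<in> ielem B C Z X V" and g: "g \<in> ielem B C Z Y V"
  shows "ileg1 f g \<in> ielem B C Z (iapex f g) X" "ileg2 f g \<in> ielem B C Z (iapex f g) Y"
proof -
  note S = icospan_props[OF f g]
  show "ileg1 f g \<in> ielem B C Z (iapex f g) X"
    using comp_hom[OF S(1) ipb1_hom] reassoc[OF icod_ipb1 ipb1_hom icod_hom ics_hom(1) idom_hom S(1)]
      S(2) ielemD(2)[OF f] by (simp add: ielem_def)
  show "ileg2 f g \<in> ielem B C Z (iapex f g) Y"
    using comp_hom[OF S(1) ipb2_hom] reassoc[OF icod_ipb2 ipb2_hom icod_hom ics_hom(2) idom_hom S(1)]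
      reassoc[OF idom_ipb ipb1_hom idom_hom ipb2_hom idom_hom S(1)]
      S(3) ielemD(2)[OF g] by (simp add: ielem_def)
qed

text \<open>Existence comes from the axiom \<open>imediate\<close>, uniqueness from
  \<open>imediate_unique\<close>, which rewrites every competitor to the same mediating
  arrow.\<close>

lemma imediate_ex1:
  assumes f: "f \<in> ielem B C Z X V" and g: "g \<in> ielem B C Z Y V"
    and a: "a \<in> ielem B C Z U X" and b: "b \<in> ielem B C Z U Y"
    and eq: "icomp B C a f = icomp B C b g"
  shows "\<exists>!h. h \<in> ielem B C Z U (iapex f g) \<and>
    icomp B C h (ileg1 f g) = a \<and> icomp B C h (ileg2 f g) = b"
proof (rule ex_ex1I)
  note D = ielemD[OF f] ielemD[OF g] ielemD[OF a] ielemD[OF b]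
  let ?h = "imediate B C f g a b"
  have i: "idom C \<cdot> ?h = idom C \<cdot> a \<and> icod C \<cdot> ?h = iapex f g \<and>
      icomp B C ?h (ileg1 f g) = a \<and> icomp B C ?h (ileg2 f g) = b"
    by (rule imediate[OF D(1) D(4) D(7) D(10) _ _ eq refl refl refl]) (simp_all add: D)
  \<comment> \<open>The axiom gives the ends and composites of \<open>?h\<close> but not its typing,
    which is read off the nested lifts in the definition of \<open>imediate\<close>.\<close>
  have "?h \<in> Hom B Z (iar C)"
  proof -
    note l = icomp_lift_props[OF a f] icomp_lift_props[OF b g]
    have "Dom B (icmp C) = Dom B (icp1 C)" using icmp_hom by (simp add: Hom_def)
    then have "lift B (isq1 C) (isq2 C) (lift B (icp1 C) (icp2 C) a f) (lift B (icp1 C) (icp2 C) b g)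
        \<in> Hom B Z (Dom B (isq1 C))"
      using lift_hom[OF isq_pullback _ _ eq[unfolded icomp_def], of Z] l(1,4) by simp
    then show ?thesis unfolding imediate_def by (rule comp_hom[OF _ imed_hom])
  qed
  then show "\<exists>h. h \<in> ielem B C Z U (iapex f g) \<and>
    icomp B C h (ileg1 f g) = a \<and> icomp B C h (ileg2 f g) = b"
    using i D(8) by (auto simp: ielem_def)
  fix h k
  assume h: "h \<in> ielem B C Z U (iapex f g) \<and> icomp B C h (ileg1 f g) = a \<and> icomp B C h (ileg2 f g) = b"
    and k: "k \<in> ielem B C Z U (iapex f g) \<and> icomp B C k (ileg1 f g) = a \<and> icomp B C k (ileg2 f g) = b"
  have u: "l = imediate B C f g a b"
    if l: "l \<in> ielem B C Z U (iapex f g)" and e: "icomp B C l (ileg1 f g) = a" "icomp B C l (ileg2 f g) = b" for l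
    using imediate_unique[OF D(1) D(4) _ refl refl ielemD(1)[OF l] ielemD(3)[OF l]] D(3,6) e by simp
  show "h = k" using u[of h] u[of k] h k by simp
qed

end

section \<open>Global sections preserve finite limits\<close>

text \<open>Data I to III of a pre-geminal category, before \<open>H\<close> enters. In this setting
  \<box> becomes a functor preserving finite limits.\<close>

locale internal_lex_model = internal_lex_category B C + strict_lex_functor B "Gamma B C" F
  for B :: "('o, 'm) lexcat" (structure) and C :: "('o, 'm) ilexcat"
    and F :: "('o, 'm, 'm, 'm) fctr"
begin

abbreviation Fo :: "'o \<Rightarrow> 'o \<Rightarrow> 'm" where "Fo Z A \<equiv> Fob F A \<cdot> bang B Z"
abbreviation Fa :: "'o \<Rightarrow> 'm \<Rightarrow> 'm" where "Fa Z f \<equiv> Far F f \<cdot> bang B Z"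
abbreviation L :: "('o, 'm, 'o, 'm) fctr" where "L \<equiv> Box B C F"
abbreviation \<iota> :: "'o \<Rightarrow> 'm" where "\<iota> A \<equiv> ihom_incl B C (itrm C) (Fob F A)"
abbreviation comp_elem :: "'m \<Rightarrow> 'm \<Rightarrow> 'm" (infixl "\<star>" 75) where "x \<star> y \<equiv> icomp B C x y"

section \<open>The functor \<open>F\<close> at an arbitrary stage\<close>

lemma F_ob: "A \<in> Obj B \<Longrightarrow> Fob F A \<in> Hom B (One B) (iob C)"
  using fob[of A] by (simp add: Gamma_def)

lemma F_ob_stage: "\<lbrakk>A \<in> Obj B; Z \<in> Obj B\<rbrakk> \<Longrightarrow> Fo Z A \<in> Hom B Z (iob C)"
  using comp_hom[OF bang_hom F_ob] .

lemma F_ar: "f \<in> Hom B A A' \<Longrightarrow> Far F f \<in> ielem B C (One B) (Fob F A) (Fob F A')"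
  using far[of f A A'] by (simp add: Gamma_def Hom_def ielem_def)

lemma F_ar_stage: "\<lbrakk>f \<in> Hom B A A'; Z \<in> Obj B\<rbrakk> \<Longrightarrow> Fa Z f \<in> ielem B C Z (Fo Z A) (Fo Z A')"
  by (rule ielem_stage[OF F_ar bang_hom])

lemma F_one: "Fob F (One B) = itrm C"
  using strict_one by (simp add: Gamma_def)

lemma F_comp:
  "\<lbrakk>f \<in> Hom B A A'; g \<in> Hom B A' A''\<rbrakk> \<Longrightarrow> Far F (g \<cdot> f) = Far F f \<star> Far F g"
  using far_comp[of f A A' g A''] by (simp add: Gamma_def)

lemma F_comp_stage:
  "\<lbrakk>f \<in> Hom B A A'; g \<in> Hom B A' A''; Z \<in> Obj B\<rbrakk> \<Longrightarrow> Fa Z (g \<cdot> f) = Fa Z f \<star> Fa Z g"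
  using F_comp icomp_stage[OF F_ar F_ar bang_hom] by simp

lemma F_id_stage: 
  assumes "A \<in> Obj B" "Z \<in> Obj B"
  shows "Fa Z (Id B A) = iid C \<cdot> Fo Z A"
  using far_id[OF assms(1)] comp_assoc[OF bang_hom[OF assms(2)] F_ob[OF assms(1)] iid_hom]
  by (simp add: Gamma_def)

lemma F_const:
  assumes "A \<in> Obj B" "k \<in> Hom B W Z" shows "Fo Z A \<cdot> k = Fo W A"
  using const_comp[OF F_ob[OF assms(1)] assms(2)] .

lemma Fa_const:
  assumes "f \<in> Hom B A A'" "k \<in> Hom B W Z" shows "Fa Z f \<cdot> k = Fa W f"
  using const_comp[OF ielemD(1)[OF F_ar[OF assms(1)]] assms(2)] .

text \<open>Strictness gives an equality of objects of \<open>C\<close>, not just an isomorphism.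
  The third claim is what makes the diagonal family in \<open>fixed_hom_object\<close> take the
  value \<open>FK\<close> on the nose.\<close>

lemma F_pb:
  assumes f: "f \<in> Hom B X W" and g: "g \<in> Hom B Y W"
  shows "Far F (Pb1 B f g) = ileg1 (Far F f) (Far F g)" "Far F (Pb2 B f g) = ileg2 (Far F f) (Far F g)"
    and "Fob F (Dom B (Pb1 B f g)) = iapex (Far F f) (Far F g)"
proof -
  have p: "f \<in> Arr B" "g \<in> Arr B" "Cod B f = Cod B g" using f g by (simp_all add: Hom_def)
  show 1: "Far F (Pb1 B f g) = ileg1 (Far F f) (Far F g)" "Far F (Pb2 B f g) = ileg2 (Far F f) (Far F g)"
    using strict_pb[OF p] by (simp_all add: Gamma_def)
  show "Fob F (Dom B (Pb1 B f g)) = iapex (Far F f) (Far F g)"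
    using ielemD(2)[OF F_ar[OF is_pullbackD(1)[OF pb_pullback[OF p]]]] 1 by simp
qed

lemma F_pb_stage:
  assumes f: "f \<in> Hom B X W" and g: "g \<in> Hom B Y W" and Z: "Z \<in> Obj B"
  shows "Fa Z (Pb1 B f g) = ileg1 (Fa Z f) (Fa Z g)" "Fa Z (Pb2 B f g) = ileg2 (Fa Z f) (Fa Z g)"
    and "Fo Z (Dom B (Pb1 B f g)) = iapex (Fa Z f) (Fa Z g)"
proof -
  note b = bang_hom[OF Z]
  note l = ileg_ielem[OF F_ar[OF f] F_ar[OF g]]
  show 1: "Fa Z (Pb1 B f g) = ileg1 (Fa Z f) (Fa Z g)" "Fa Z (Pb2 B f g) = ileg2 (Fa Z f) (Fa Z g)"
    unfolding F_pb[OF f g] using ileg_stage[OF F_ar[OF f] F_ar[OF g] b] by simp_all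
  show "Fo Z (Dom B (Pb1 B f g)) = iapex (Fa Z f) (Fa Z g)"
    unfolding F_pb[OF f g] comp_assoc[OF b ielemD(1)[OF l(1)] idom_hom]
    using 1(1) unfolding F_pb[OF f g] by simp
qed

text \<open>The source \<open>U\<close> is an arbitrary object of \<open>C\<close>: it will be
  \<open>1\<close> when \<box> is shown to preserve pullbacks, and \<open>FY\<close> when partial
  application is built.\<close>

lemma F_pb_ex1:
  assumes f: "f \<in> Hom B X W" and g: "g \<in> Hom B Y W"
    and a: "a \<in> ielem B C Z U (Fo Z X)" and b: "b \<in> ielem B C Z U (Fo Z Y)"
    and eq: "a \<star> Fa Z f = b \<star> Fa Z g"
  shows "\<exists>!h. h \<in> ielem B C Z U (Fo Z (Dom B (Pb1 B f g))) \<and>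
    h \<star> Fa Z (Pb1 B f g) = a \<and> h \<star> Fa Z (Pb2 B f g) = b"
proof -
  have Z: "Z \<in> Obj B" using hom_objs[OF ielemD(1)[OF a]] by simp
  show ?thesis
    unfolding F_pb_stage[OF f g Z]
    by (rule imediate_ex1[OF F_ar_stage[OF f Z] F_ar_stage[OF g Z] a b eq])
qed

text \<open>From here on a map \<open>x\<close> into \<box>A is handled as the family \<iota>A
  \<cdot> x of arrows \<open>1\<close> \<rightarrow> \<open>FA\<close> of \<open>C\<close>, and
  equations between such maps are tested after the monomorphism \<iota>A.\<close>

lemma iota_hom_object: "A \<in> Obj B \<Longrightarrow> hom_object B C (Fob L A) (itrm C) (Fob F A) (\<iota> A)"
  using ihom_object(1)[OF itrm_hom F_ob] by (simp add: Box_def fctr_comp_def gsec_def)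

lemma iota_hom: "A \<in> Obj B \<Longrightarrow> \<iota> A \<in> Hom B (Fob L A) (iar C)"
  using hom_objectD(2)[OF iota_hom_object] .

lemma L_ob: "A \<in> Obj B \<Longrightarrow> Fob L A \<in> Obj B"
  using iota_hom hom_objs by blast

lemma iota_elem:
  "\<lbrakk>A \<in> Obj B; x \<in> Hom B Z (Fob L A)\<rbrakk> \<Longrightarrow> \<iota> A \<cdot> x \<in> ielem B C Z (itrm C \<cdot> bang B Z) (Fo Z A)"
  using hom_object_elem[OF iota_hom_object itrm_hom F_ob] .

lemma iota_mono:
  "\<lbrakk>A \<in> Obj B; x \<in> Hom B Z (Fob L A); y \<in> Hom B Z (Fob L A); \<iota> A \<cdot> x = \<iota> A \<cdot> y\<rbrakk> \<Longrightarrow> x = y"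
  using hom_object_mono[OF iota_hom_object itrm_hom F_ob] .

lemma iota_ex1:
  "\<lbrakk>A \<in> Obj B; x \<in> ielem B C Z (itrm C \<cdot> bang B Z) (Fo Z A)\<rbrakk>
    \<Longrightarrow> \<exists>!h. h \<in> Hom B Z (Fob L A) \<and> \<iota> A \<cdot> h = x"
  using hom_object_ex1[OF iota_hom_object] .

lemma L_far:
  assumes f: "f \<in> Hom B A A'"
  shows "Far L f \<in> Hom B (Fob L A) (Fob L A')" "\<iota> A' \<cdot> Far L f = \<iota> A \<star> Fa (Fob L A) f"
proof -
  have o: "A \<in> Obj B" "A' \<in> Obj B" using hom_objs[OF f] by auto
  have e: "\<iota> A \<star> Fa (Fob L A) f \<in> ielem B C (Fob L A) (itrm C \<cdot> bang B (Fob L A)) (Fo (Fob L A) A')"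
    by (rule icomp_ielem[OF hom_objectD(1)[OF iota_hom_object[OF o(1)]] F_ar_stage[OF f L_ob[OF o(1)]]])
  have fo: "Fob L X = ihom B C (itrm C) (Fob F X)" for X by (simp add: Box_def fctr_comp_def gsec_def)
  have "Far L f = ihom_lift B C (itrm C) (Fob F A') (\<iota> A \<star> Fa (Fob L A) f)"
    using ielemD(2,3)[OF F_ar[OF f]] by (simp add: Box_def fctr_comp_def gsec_def)
  then show "Far L f \<in> Hom B (Fob L A) (Fob L A')" "\<iota> A' \<cdot> Far L f = \<iota> A \<star> Fa (Fob L A) f"
    using ihom_lift[OF itrm_hom F_ob[OF o(2)] e] by (simp_all add: fo)
qed

lemma L_far_elem:
  assumes f: "f \<in> Hom B A A'" and x: "x \<in> Hom B Z (Fob L A)"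
  shows "\<iota> A' \<cdot> (Far L f \<cdot> x) = (\<iota> A \<cdot> x) \<star> Fa Z f"
proof -
  have o: "A \<in> Obj B" "A' \<in> Obj B" using hom_objs[OF f] by auto
  have "\<iota> A' \<cdot> (Far L f \<cdot> x) = (\<iota> A \<star> Fa (Fob L A) f) \<cdot> x"
    using comp_assoc[OF x L_far(1)[OF f] iota_hom[OF o(2)]] L_far(2)[OF f] by simp
  also have "\<dots> = (\<iota> A \<cdot> x) \<star> (Fa (Fob L A) f \<cdot> x)"
    by (rule icomp_stage[OF hom_objectD(1)[OF iota_hom_object[OF o(1)]] F_ar_stage[OF f L_ob[OF o(1)]] x])
  finally show ?thesis unfolding Fa_const[OF f x] .
qed

lemma L_comp:
  assumes f: "f \<in> Hom B X Y" and g: "g \<in> Hom B Y W"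
  shows "Far L (g \<cdot> f) = Far L g \<cdot> Far L f"
proof -
  have o: "X \<in> Obj B" "Y \<in> Obj B" "W \<in> Obj B" using hom_objs[OF f] hom_objs[OF g] by auto
  note gf = comp_hom[OF f g] and LX = L_ob[OF o(1)]
  note iX = hom_objectD(1)[OF iota_hom_object[OF o(1)]]
  show ?thesis
  proof (rule iota_mono[OF o(3) L_far(1)[OF gf] comp_hom[OF L_far(1)[OF f] L_far(1)[OF g]]])
    show "\<iota> W \<cdot> Far L (g \<cdot> f) = \<iota> W \<cdot> Far L g \<cdot> Far L f"
      unfolding L_far(2)[OF gf] L_far_elem[OF g L_far(1)[OF f]] L_far(2)[OF f] F_comp_stage[OF f g LX]
      by (rule icomp_assoc[OF iX F_ar_stage[OF f LX] F_ar_stage[OF g LX], symmetric])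
  qed
qed

lemma L_id:
  assumes "A \<in> Obj B"
  shows "Far L (Id B A) = Id B (Fob L A)"
proof (rule iota_mono[OF assms L_far(1)[OF id_hom[OF assms]] id_hom[OF L_ob[OF assms]]])
  show "\<iota> A \<cdot> Far L (Id B A) = \<iota> A \<cdot> Id B (Fob L A)"
    unfolding L_far(2)[OF id_hom[OF assms]] id_right[OF iota_hom[OF assms]] F_id_stage[OF assms L_ob[OF assms]]
    by (rule icomp_iid_right[OF hom_objectD(1)[OF iota_hom_object[OF assms]]])
qed

lemma L_functor: "is_functor B B L"
  using L_ob L_far(1) L_id L_comp by unfold_locales

lemma L_comp_ap:
  assumes f: "f \<in> Hom B X Y" and g: "g \<in> Hom B Y W" and x: "x \<in> Hom B Z (Fob L X)"
  shows "Far L g \<cdot> (Far L f \<cdot> x) = Far L (g \<cdot> f) \<cdot> x"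
  unfolding L_comp[OF f g] comp_assoc[OF x L_far(1)[OF f] L_far(1)[OF g]] ..

text \<open>\<box>1 is \<open>C(1, F1)\<close> = \<open>C(1, 1)\<close> because \<open>F\<close>
  preserves the terminal object strictly, and the internal terminal object admits at most one arrow
  from any source.\<close>

lemma to_L_one_unique:
  assumes x: "x \<in> Hom B Z (Fob L (One B))" and y: "y \<in> Hom B Z (Fob L (One B))"
  shows "x = y"
  by (rule iota_mono[OF one_obj x y], rule to_itrm_unique)
    (use iota_elem[OF one_obj x] iota_elem[OF one_obj y] F_one in simp_all)

lemma one_iso_hom: "one_iso B B L \<in> Hom B (One B) (Fob L (One B))"
proof -
  \<comment> \<open>The identity of the internal terminal object supplies the global element of
    \<box>1.\<close>
  have e: "iid C \<cdot> itrm C \<in> ielem B C (One B) (itrm C \<cdot> bang B (One B)) (Fo (One B) (One B))"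
    using iid_ielem[OF itrm_hom] id_right[OF itrm_hom] F_one by simp
  obtain u where u: "u \<in> Hom B (One B) (Fob L (One B))" 
    using iota_ex1[OF one_obj e] by blast
  let ?b = "bang B (Fob L (One B))"
  have b: "?b \<in> Hom B (Fob L (One B)) (One B)" using bang_hom[OF L_ob[OF one_obj]] .
  have d: "u \<in> Arr B" "Dom B u = One B" "Cod B u = Fob L (One B)" using u by (simp_all add: Hom_def)
  have "is_iso B u"
    unfolding is_iso_def d
    using d(1) b to_one_unique[OF comp_hom[OF u b] id_hom[OF one_obj]]
      to_L_one_unique[OF comp_hom[OF b u] id_hom[OF L_ob[OF one_obj]]] by blast
  then have "\<exists>!u. u \<in> Hom B (One B) (Fob L (One B)) \<and> is_iso B u"
    using u to_L_one_unique by blast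
  from theI'[OF this] show ?thesis unfolding one_iso_def by blast
qed

text \<open>A compatible pair of elements of \<box>X and \<box>Y is a pair of arrows from
  \<open>1\<close> into \<open>FX\<close> and \<open>FY\<close> with equal composites.
  \<open>F\<close> sends the chosen pullback to an internal one, so the pair factors uniquely
  through it, and this factorisation is an element of \<box> of the pullback.\<close>

lemma L_pullback_chosen:
  assumes f: "f \<in> Hom B X W" and g: "g \<in> Hom B Y W"
  shows "is_pullback B (Far L f) (Far L g) (Far L (Pb1 B f g)) (Far L (Pb2 B f g))"
proof -
  let ?p = "Pb1 B f g" and ?q = "Pb2 B f g" and ?P = "Dom B (Pb1 B f g)"
  have d: "f \<in> Arr B" "g \<in> Arr B" "Cod B f = Cod B g" "Dom B f = X" "Dom B g = Y"
    using f g by (simp_all add: Hom_def)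
  note pb = is_pullbackD[OF pb_pullback[OF d(1-3)], unfolded d(4,5)]
  note p = pb(1) and q = pb(2)
  have o: "X \<in> Obj B" "Y \<in> Obj B" "W \<in> Obj B" "?P \<in> Obj B"
    using hom_objs[OF f] hom_objs[OF g] hom_objs[OF p] by auto
  show ?thesis
  proof (rule is_pullbackI[OF L_far(1)[OF f] L_far(1)[OF g] L_far(1)[OF p] L_far(1)[OF q]])
    show "Far L f \<cdot> Far L ?p = Far L g \<cdot> Far L ?q"
      using L_comp[OF p f] L_comp[OF q g] pb(3) by simp
    fix Z a b
    assume a: "a \<in> Hom B Z (Fob L X)" and b: "b \<in> Hom B Z (Fob L Y)" and eq: "Far L f \<cdot> a = Far L g \<cdot> b"
    have "(\<iota> X \<cdot> a) \<star> Fa Z f = (\<iota> Y \<cdot> b) \<star> Fa Z g"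
      using L_far_elem[OF f a] L_far_elem[OF g b] eq by simp
    note ex1 = F_pb_ex1[OF f g iota_elem[OF o(1) a] iota_elem[OF o(2) b] this]
    have iff: "Far L ?p \<cdot> h = a \<longleftrightarrow> (\<iota> ?P \<cdot> h) \<star> Fa Z ?p = \<iota> X \<cdot> a"
      "Far L ?q \<cdot> h = b \<longleftrightarrow> (\<iota> ?P \<cdot> h) \<star> Fa Z ?q = \<iota> Y \<cdot> b" if h: "h \<in> Hom B Z (Fob L ?P)" for h
      using iota_mono[OF o(1) comp_hom[OF h L_far(1)[OF p]] a] L_far_elem[OF p h]
        iota_mono[OF o(2) comp_hom[OF h L_far(1)[OF q]] b] L_far_elem[OF q h] by auto
    show "\<exists>!h. h \<in> Hom B Z (Fob L ?P) \<and> Far L ?p \<cdot> h = a \<and> Far L ?q \<cdot> h = b"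
    proof (rule ex_ex1I)
      obtain e where e: "e \<in> ielem B C Z (itrm C \<cdot> bang B Z) (Fo Z ?P)"
        "e \<star> Fa Z ?p = \<iota> X \<cdot> a" "e \<star> Fa Z ?q = \<iota> Y \<cdot> b"
        using ex1_implies_ex[OF ex1] by blast
      obtain h where "h \<in> Hom B Z (Fob L ?P)" "\<iota> ?P \<cdot> h = e" using iota_ex1[OF o(4) e(1)] by blast
      then show "\<exists>h. h \<in> Hom B Z (Fob L ?P) \<and> Far L ?p \<cdot> h = a \<and> Far L ?q \<cdot> h = b"
        using iff[of h] e by blast
      fix h k
      assume h: "h \<in> Hom B Z (Fob L ?P) \<and> Far L ?p \<cdot> h = a \<and> Far L ?q \<cdot> h = b"
        and k: "k \<in> Hom B Z (Fob L ?P) \<and> Far L ?p \<cdot> k = a \<and> Far L ?q \<cdot> k = b"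
      have "\<iota> ?P \<cdot> h = \<iota> ?P \<cdot> k"
        using ex1 iff[of h] iff[of k] h k iota_elem[OF o(4), of h Z] iota_elem[OF o(4), of k Z] by blast
      then show "h = k" using iota_mono[OF o(4), of h Z k] h k by blast
    qed
  qed
qed

text \<open>The pullbacks in the data of \<open>C\<close> need not be chosen ones, so preservation
  is transported along the comparison maps \<open>k\<close> into the chosen pullback and
  \<open>m\<close> back. Existence uses \<box>m; uniqueness uses that \<box>k is split monic, by
  \<open>mk\<close>.\<close>

lemma L_pullback:
  assumes pb: "is_pullback B f g p q"
  shows "is_pullback B (Far L f) (Far L g) (Far L p) (Far L q)"
proof -
  note D = is_pullbackD[OF pb]
  have cf: "Cod B f = Cod B g" "f \<in> Arr B" "g \<in> Arr B" using D by (simp_all add: Hom_def)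
  let ?p = "Pb1 B f g" and ?q = "Pb2 B f g"
  note pb' = pb_pullback[OF cf(2,3,1)]
  note D' = is_pullbackD[OF pb'] and Lpb' = L_pullback_chosen[OF D(4,5)]
  define k where "k = lift B ?p ?q p q"
  define m where "m = lift B p q ?p ?q"
  note K = lift_props[OF pb' D(1,2,3), folded k_def] and M = lift_props[OF pb D'(1,2,3), folded m_def]
  have LP: "Dom B (Far L ?p) = Fob L (Dom B ?p)" "Dom B (Far L f) = Fob L (Dom B f)" "Dom B (Far L g) = Fob L (Dom B g)"
    using L_far(1)[OF D'(1)] L_far(1)[OF D(4)] L_far(1)[OF D(5)] by (simp_all add: Hom_def)
  have mk: "m \<cdot> k = Id B (Dom B p)"
  proof (rule pullback_unique[OF pb comp_hom[OF K(1) M(1)] id_hom])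
    show "Dom B p \<in> Obj B" using hom_objs[OF D(1)] by simp
    show "p \<cdot> m \<cdot> k = p \<cdot> Id B (Dom B p)" "q \<cdot> m \<cdot> k = q \<cdot> Id B (Dom B p)"
      using comp_assoc[OF K(1) M(1) D(1)] comp_assoc[OF K(1) M(1) D(2)] K(2,3) M(2,3)
        id_right[OF D(1)] id_right[OF D(2)] by simp_all
  qed
  show ?thesis
  proof (rule is_pullbackI[OF L_far(1)[OF D(4)] L_far(1)[OF D(5)] L_far(1)[OF D(1)] L_far(1)[OF D(2)]])
    show "Far L f \<cdot> Far L p = Far L g \<cdot> Far L q"
      using L_comp[OF D(1,4)] L_comp[OF D(2,5)] D(3) by simp
    fix Z a b
    assume a: "a \<in> Hom B Z (Fob L (Dom B f))" and b: "b \<in> Hom B Z (Fob L (Dom B g))"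
      and eq: "Far L f \<cdot> a = Far L g \<cdot> b"
    let ?h = "lift B (Far L ?p) (Far L ?q) a b"
    note H = lift_props[OF Lpb' _ _ eq, unfolded LP, OF a b]
    show "\<exists>!h. h \<in> Hom B Z (Fob L (Dom B p)) \<and> Far L p \<cdot> h = a \<and> Far L q \<cdot> h = b"
    proof (rule ex_ex1I)
      show "\<exists>h. h \<in> Hom B Z (Fob L (Dom B p)) \<and> Far L p \<cdot> h = a \<and> Far L q \<cdot> h = b"
        using comp_hom[OF H(1) L_far(1)[OF M(1)]] L_comp_ap[OF M(1) D(1) H(1)] L_comp_ap[OF M(1) D(2) H(1)]
          M(2,3) H(2,3) by auto
      fix x y
      assume "x \<in> Hom B Z (Fob L (Dom B p)) \<and> Far L p \<cdot> x = a \<and> Far L q \<cdot> x = b"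
        "y \<in> Hom B Z (Fob L (Dom B p)) \<and> Far L p \<cdot> y = a \<and> Far L q \<cdot> y = b"
      then have x: "x \<in> Hom B Z (Fob L (Dom B p))" and y: "y \<in> Hom B Z (Fob L (Dom B p))"
        and xy: "Far L p \<cdot> x = Far L p \<cdot> y" "Far L q \<cdot> x = Far L q \<cdot> y" by auto
      have "Far L k \<cdot> x = Far L k \<cdot> y"
        by (rule pullback_unique[OF Lpb', unfolded LP, OF comp_hom[OF x L_far(1)[OF K(1)]] comp_hom[OF y L_far(1)[OF K(1)]]])
          (use L_comp_ap[OF K(1) D'(1) x] L_comp_ap[OF K(1) D'(1) y] L_comp_ap[OF K(1) D'(2) x]
            L_comp_ap[OF K(1) D'(2) y] K(2,3) xy in simp_all)
      then have "Far L (m \<cdot> k) \<cdot> x = Far L (m \<cdot> k) \<cdot> y"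
        using L_comp_ap[OF K(1) M(1) x] L_comp_ap[OF K(1) M(1) y] by simp
      then show "x = y"
        unfolding mk using L_id[of "Dom B p"] hom_objs[OF D(1)] id_left[OF x] id_left[OF y] by simp
    qed
  qed
qed

text \<open>A monomorphism is an arrow whose kernel pair is given by two identities, and \<box>
  preserves that pullback square.\<close>

lemma L_mono:
  assumes j: "j \<in> Hom B K Y"
    and mono: "\<And>Z h k. \<lbrakk>h \<in> Hom B Z K; k \<in> Hom B Z K; j \<cdot> h = j \<cdot> k\<rbrakk> \<Longrightarrow> h = k"
    and x: "x \<in> Hom B Z (Fob L K)" and y: "y \<in> Hom B Z (Fob L K)" and eq: "Far L j \<cdot> x = Far L j \<cdot> y"
  shows "x = y"
proof -
  have K: "K \<in> Obj B" using hom_objs[OF j] by simp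
  note i = id_hom[OF K]
  have "is_pullback B j j (Id B K) (Id B K)"
  proof (rule is_pullbackI[OF j j i i refl])
    fix Z a b assume "a \<in> Hom B Z K" "b \<in> Hom B Z K" "j \<cdot> a = j \<cdot> b"
    then show "\<exists>!h. h \<in> Hom B Z K \<and> Id B K \<cdot> h = a \<and> Id B K \<cdot> h = b"
      using mono[of a Z b] id_left by metis
  qed
  note pb = L_pullback[OF this, unfolded L_id[OF K]]
  have d: "Dom B (Far L j) = Fob L K" "Dom B (Id B (Fob L K)) = Fob L K"
    using L_far(1)[OF j] L_ob[OF K] by (simp_all add: Hom_def)
  note l = lift_props[OF pb _ _ eq, unfolded d, OF x y]
  show ?thesis using l(2,3) id_left[OF l(1)] by simp
qed

section \<open>The internal category \<box>C and its hom-objects\<close>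

abbreviation D :: "('o, 'm) ilexcat" where "D \<equiv> BoxC B C F"

lemma box_simps [simp]:
  "iob D = Fob L (iob C)" "iar D = Fob L (iar C)" "idom D = Far L (idom C)" "icod D = Far L (icod C)"
  "iid D = Far L (iid C)" "icp1 D = Far L (icp1 C)" "icp2 D = Far L (icp2 C)" "icmp D = Far L (icmp C)"
  by (simp_all add: BoxC_def app_icat_def)

lemma sharp_hom: "x \<in> Hom B (One B) Y \<Longrightarrow> sharp B B L x \<in> Hom B (One B) (Fob L Y)"
  unfolding sharp_def by (rule comp_hom[OF one_iso_hom L_far(1)])

text \<open>A constant family factors through \<open>1\<close>, and all maps from \<open>Z\<close>
  into \<box>1 agree; hence the result does not depend on \<open>k\<close>.\<close>

lemma L_const:
  assumes x: "x \<in> Hom B (One B) Y" and K: "K \<in> Obj B" and k: "k \<in> Hom B Z (Fob L K)"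
  shows "Far L (x \<cdot> bang B K) \<cdot> k = sharp B B L x \<cdot> bang B Z"
proof -
  have Z: "Z \<in> Obj B" using hom_objs[OF k] by simp
  note b = bang_hom[OF K] and Lx = L_far(1)[OF x]
  have "Far L (bang B K) \<cdot> k = one_iso B B L \<cdot> bang B Z"
    by (rule to_L_one_unique[OF comp_hom[OF k L_far(1)[OF b]] comp_hom[OF bang_hom[OF Z] one_iso_hom]])
  then show ?thesis
    using L_comp_ap[OF b x k] comp_assoc[OF bang_hom[OF Z] one_iso_hom Lx] by (simp add: sharp_def)
qed

lemma L_ielem:
  assumes x: "x \<in> ielem B C Z X Y"
  shows "Far L x \<in> ielem B D (Fob L Z) (Far L X) (Far L Y)"
  using L_far(1)[OF ielemD(1)[OF x]] L_comp[OF ielemD(1)[OF x] idom_hom] L_comp[OF ielemD(1)[OF x] icod_hom]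
    ielemD(2,3)[OF x] by (simp add: ielem_def)

lemma L_icomp:
  assumes x: "x \<in> ielem B C Z X Y" and y: "y \<in> ielem B C Z Y W"
  shows "Far L (icomp B C x y) = icomp B D (Far L x) (Far L y)"
proof -
  note l = icomp_lift_props[OF x y] and pb = L_pullback[OF icp_pullback]
  have d: "Dom B (Far L (icod C)) = Fob L (iar C)" "Dom B (Far L (idom C)) = Fob L (iar C)"
    "Dom B (Far L (icp1 C)) = Fob L (Dom B (icp1 C))"
    using L_far(1)[OF icod_hom] L_far(1)[OF idom_hom] L_far(1)[OF icp_hom(1)] by (simp_all add: Hom_def)
  have eq: "Far L (icod C) \<cdot> Far L x = Far L (idom C) \<cdot> Far L y"
    using L_comp[OF ielemD(1)[OF x] icod_hom] L_comp[OF ielemD(1)[OF y] idom_hom]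
      ielemD(3)[OF x] ielemD(2)[OF y] by simp
  note l' = lift_props[OF pb _ _ eq, unfolded d, OF L_far(1)[OF ielemD(1)[OF x]] L_far(1)[OF ielemD(1)[OF y]]]
  have "Far L (lift B (icp1 C) (icp2 C) x y) = lift B (Far L (icp1 C)) (Far L (icp2 C)) (Far L x) (Far L y)"
    by (rule pullback_unique[OF pb, unfolded d, OF L_far(1)[OF l(1)] l'(1)])
      (use L_comp[OF l(1) icp_hom(1)] L_comp[OF l(1) icp_hom(2)] l(2,3) l'(2,3) in simp_all)
  then show ?thesis
    unfolding icomp_def using L_comp[OF l(1) icmp_hom] by simp
qed

text \<open>This is (\<box>C)(\<box>#X, \<box>#Y) \<cong> \<box>(C(X, Y)) without a chosen
  isomorphism. \<box> preserves the defining pullback square, and \<open>one_iso\<close> replaces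
  its corner \<box>1 by \<open>1\<close>.\<close>

lemma L_hom_object:
  assumes p: "hom_object B C K X Y p" and X: "X \<in> Hom B (One B) (iob C)" and Y: "Y \<in> Hom B (One B) (iob C)"
  shows "hom_object B D (Fob L K) (sharp B B L X) (sharp B B L Y) (Far L p)"
proof -
  note pK = hom_objectD(2)[OF p]
  have K: "K \<in> Obj B" using hom_objs[OF pK] by simp
  let ?e = "pair B (idom C) (icod C)" and ?g = "pair B X Y" and ?P = "Prd B (iob C) (iob C)"
    and ?u = "one_iso B B L"
  note e = pair_props[OF idom_hom icod_hom] and g = pair_props[OF X Y] and pr = pr_hom[OF iob_obj iob_obj]
  note pb = L_pullback[OF hom_object_iff_pullback[OF X Y pK, THEN iffD1, OF p]]
    and pbp = L_pullback[OF prod_pullback[OF iob_obj iob_obj]]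
  have d: "Dom B (Far L ?e) = Fob L (iar C)" "Dom B (Far L ?g) = Fob L (One B)" "Dom B (Far L p) = Fob L K"
    "Dom B (Far L (Pr1 B (iob C) (iob C))) = Fob L ?P"
    using L_far(1)[OF e(1)] L_far(1)[OF g(1)] L_far(1)[OF pK] L_far(1)[OF pr(1)] by (simp_all add: Hom_def)
  have "Far L p \<in> ielem B D (Fob L K) (sharp B B L X \<cdot> bang B (Fob L K)) (sharp B B L Y \<cdot> bang B (Fob L K))"
    using L_ielem[OF hom_objectD(1)[OF p]]
      L_const[OF X K id_hom[OF L_ob[OF K]]] L_const[OF Y K id_hom[OF L_ob[OF K]]]
      id_right[OF L_far(1)[OF comp_hom[OF bang_hom[OF K] X]]]
      id_right[OF L_far(1)[OF comp_hom[OF bang_hom[OF K] Y]]] by simp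
  moreover have "\<exists>!h. h \<in> Hom B Z (Fob L K) \<and> Far L p \<cdot> h = x"
    if x: "x \<in> ielem B D Z (sharp B B L X \<cdot> bang B Z) (sharp B B L Y \<cdot> bang B Z)" for Z x
  proof -
    have xh: "x \<in> Hom B Z (Fob L (iar C))" using ielemD(1)[OF x] by simp
    have Z: "Z \<in> Obj B" using hom_objs[OF xh] by simp
    note uz = comp_hom[OF bang_hom[OF Z] one_iso_hom]
    \<comment> \<open>The image under \<box> of a product is again a pullback, so its two
      projections are jointly monic and the ends can be compared separately.\<close>
    have eq: "Far L ?e \<cdot> x = Far L ?g \<cdot> (?u \<cdot> bang B Z)"
    proof (rule pullback_unique[OF pbp, unfolded d, OF comp_hom[OF xh L_far(1)[OF e(1)]] comp_hom[OF uz L_far(1)[OF g(1)]]])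
      show "Far L (Pr1 B (iob C) (iob C)) \<cdot> Far L ?e \<cdot> x = Far L (Pr1 B (iob C) (iob C)) \<cdot> Far L ?g \<cdot> ?u \<cdot> bang B Z"
        unfolding L_comp_ap[OF e(1) pr(1) xh] L_comp_ap[OF g(1) pr(1) uz] e g
        using ielemD(2)[OF x] comp_assoc[OF bang_hom[OF Z] one_iso_hom L_far(1)[OF X]] by (simp add: sharp_def)
      show "Far L (Pr2 B (iob C) (iob C)) \<cdot> Far L ?e \<cdot> x = Far L (Pr2 B (iob C) (iob C)) \<cdot> Far L ?g \<cdot> ?u \<cdot> bang B Z"
        unfolding L_comp_ap[OF e(1) pr(2) xh] L_comp_ap[OF g(1) pr(2) uz] e g
        using ielemD(3)[OF x] comp_assoc[OF bang_hom[OF Z] one_iso_hom L_far(1)[OF Y]] by (simp add: sharp_def)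
    qed
    note l = lift_props[OF pb _ _ eq, unfolded d, OF xh uz]
    show ?thesis
    proof (rule ex_ex1I)
      show "\<exists>h. h \<in> Hom B Z (Fob L K) \<and> Far L p \<cdot> h = x" using l(1,2) by blast
      fix h k
      assume "h \<in> Hom B Z (Fob L K) \<and> Far L p \<cdot> h = x" "k \<in> Hom B Z (Fob L K) \<and> Far L p \<cdot> k = x"
      then have h: "h \<in> Hom B Z (Fob L K)" and k: "k \<in> Hom B Z (Fob L K)" and hk: "Far L p \<cdot> h = Far L p \<cdot> k"
        by auto
      note b = L_far(1)[OF bang_hom[OF K]]
      show "h = k"
        by (rule pullback_unique[OF pb, unfolded d, OF h k hk to_L_one_unique[OF comp_hom[OF h b] comp_hom[OF k b]]])
    qed
  qed
  ultimately show ?thesis unfolding hom_object_def by blast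
qed

end

text \<open>Existence and uniqueness behind the definite description in \<open>ihom_iso\<close>: two
  hom-objects with the same ends factor through each other, and both inclusions are monic.\<close>

lemma (in internal_category) hom_object_iso_ex1:
  assumes X: "X \<in> Hom B (One B) (iob C)" and Y: "Y \<in> Hom B (One B) (iob C)"
    and p: "hom_object B C K X Y p" and q: "hom_object B C K' X Y q"
  shows "\<exists>!k. k \<in> Hom B K K' \<and> is_iso B k \<and> q \<cdot> k = p"
proof -
  obtain k where k: "k \<in> Hom B K K'" "q \<cdot> k = p" using hom_object_factor[OF q hom_objectD(1)[OF p]] .
  obtain m where m: "m \<in> Hom B K' K" "p \<cdot> m = q" using hom_object_factor[OF p hom_objectD(1)[OF q]] .
  note ph = hom_objectD(2)[OF p] and qh = hom_objectD(2)[OF q]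
  have o: "K \<in> Obj B" "K' \<in> Obj B" using hom_objs[OF k(1)] by auto
  have mk: "m \<cdot> k = Id B K"
    by (rule hom_object_mono[OF p X Y comp_hom[OF k(1) m(1)] id_hom[OF o(1)]])
      (use comp_assoc[OF k(1) m(1) ph] k m id_right[OF ph] in simp)
  have km: "k \<cdot> m = Id B K'"
    by (rule hom_object_mono[OF q X Y comp_hom[OF m(1) k(1)] id_hom[OF o(2)]])
      (use comp_assoc[OF m(1) k(1) qh] k m id_right[OF qh] in simp)
  have "is_iso B k"
    using k(1) m(1) mk km by (auto simp: is_iso_def Hom_def)
  then show ?thesis using k hom_object_mono[OF q X Y] by blast
qed

section \<open>The coalgebra structure\<close>

sublocale pre_geminal_category \<subseteq> internal_lex_model B C F ..

context pre_geminal_category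
begin

lemma ihom_iso_props:
  assumes X: "X \<in> Hom B (One B) (iob C)" and Y: "Y \<in> Hom B (One B) (iob C)"
  shows "ihom_iso B B L C X Y \<in> Hom B (ihom B D (sharp B B L X) (sharp B B L Y)) (Fob L (ihom B C X Y))"
    and "Far L (ihom_incl B C X Y) \<cdot> ihom_iso B B L C X Y = ihom_incl B D (sharp B B L X) (sharp B B L Y)"
proof -
  have s: "sharp B B L X \<in> Hom B (One B) (iob D)" "sharp B B L Y \<in> Hom B (One B) (iob D)"
    using sharp_hom[OF X] sharp_hom[OF Y] by simp_all
  note ex1 = cod.hom_object_iso_ex1[OF s cod.ihom_object(1)[OF s] L_hom_object[OF ihom_object(1)[OF X Y] X Y]]
  note t = theI'[OF ex1]
  show "ihom_iso B B L C X Y \<in> Hom B (ihom B D (sharp B B L X) (sharp B B L Y)) (Fob L (ihom B C X Y))"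
    "Far L (ihom_incl B C X Y) \<cdot> ihom_iso B B L C X Y = ihom_incl B D (sharp B B L X) (sharp B B L Y)"
    using t unfolding ihom_iso_def BoxC_def by blast+
qed

abbreviation \<delta> :: "'o \<Rightarrow> 'm" where "\<delta> \<equiv> sigma B C F H"

text \<open>Both factors of \<open>sigma\<close> are compatible with the inclusions into
  \<box>(\<open>iar C\<close>). Since \<box>\<iota>A is monic, the second claim determines
  \<delta>A, and later arguments use it in place of the definition.\<close>

lemma delta_props:
  assumes A: "A \<in> Obj B"
  shows delta_hom: "\<delta> A \<in> Hom B (Fob L A) (Fob L (Fob L A))"
    and L_iota_delta: "Far L (\<iota> A) \<cdot> \<delta> A = Har H \<cdot> \<iota> A"
proof -
  \<comment> \<open>With \<open>F1\<close> = \<open>1\<close>, the object part of the strict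
    equation on \<open>H\<close> and \<open>F\<close> makes the codomain of \<open>ifun_hom\<close>
    equal to the domain of \<open>ihom_iso\<close>.\<close>
  have h: "Hob H \<cdot> itrm C = sharp B B L (itrm C)" "Hob H \<cdot> Fob F A = sharp B B L (Fob F A)"
    using h_fob[OF one_obj] h_fob[OF A] F_one by simp_all
  note FA = F_ob[OF A] and i = iota_hom[OF A]
  have LA: "Fob L X = ihom B C (itrm C) (Fob F X)" for X by (simp add: Box_def fctr_comp_def gsec_def)
  have s: "sharp B B L (itrm C) \<in> Hom B (One B) (iob D)" "sharp B B L (Fob F A) \<in> Hom B (One B) (iob D)"
    using sharp_hom[OF itrm_hom] sharp_hom[OF FA] by simp_all
  note k = ihom_iso_props[OF itrm_hom FA]
  have b: "bang B (Fob L A) \<in> Hom B (Fob L A) (One B)" using bang_hom[OF L_ob[OF A]] .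
  have "Har H \<cdot> \<iota> A \<in> ielem B D (Fob L A) (sharp B B L (itrm C) \<cdot> bang B (Fob L A))
      (sharp B B L (Fob F A) \<cdot> bang B (Fob L A))"
    using har_ielem[OF hom_objectD(1)[OF iota_hom_object[OF A]]]
      comp_assoc[OF b itrm_hom hob] comp_assoc[OF b FA hob] h by simp
  note l = cod.ihom_lift[OF s this]
  note L_incl = L_far(1)[OF i]
  have sg: "\<delta> A = ihom_iso B B L C (itrm C) (Fob F A) \<cdot>
      ihom_lift B D (sharp B B L (itrm C)) (sharp B B L (Fob F A)) (Har H \<cdot> \<iota> A)"
    by (simp add: sigma_def ifun_hom_def h)
  show "\<delta> A \<in> Hom B (Fob L A) (Fob L (Fob L A))"
    unfolding sg using comp_hom[OF l(1) k(1)] by (simp add: LA)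
  have k1: "ihom_iso B B L C (itrm C) (Fob F A) \<in>
    Hom B (ihom B D (sharp B B L (itrm C)) (sharp B B L (Fob F A))) (Fob L (Fob L A))"
    using k(1) by (simp add: LA)
  show "Far L (\<iota> A) \<cdot> \<delta> A = Har H \<cdot> \<iota> A"
    unfolding sg using comp_assoc[OF l(1) k1 L_incl] k(2) l(2) by simp
qed

lemma har_box: "Har H \<in> Hom B (iar C) (Fob L (iar C))"
  using har by simp

text \<open>The arrow part of the strict equation on \<open>H\<close> and \<open>F\<close>, read at
  a stage: \<open>H\<close> turns the constant family \<open>Ff\<close> into the constant family
  \<box>(\<open>Ff\<close>).\<close>

lemma har_const:
  assumes f: "f \<in> Hom B A A'" and K: "K \<in> Obj B" and k: "k \<in> Hom B Z (Fob L K)"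
  shows "Har H \<cdot> Fa Z f = Far L (Fa K f) \<cdot> k"
proof -
  have Z: "Z \<in> Obj B" using hom_objs[OF k] by simp
  note Ff = ielemD(1)[OF F_ar[OF f]]
  have "f \<in> Arr B" using f by (simp add: Hom_def)
  then show ?thesis
    using h_far comp_assoc[OF bang_hom[OF Z] Ff har] L_const[OF Ff K k] by simp
qed

lemma L_iota_mono:
  "\<lbrakk>A \<in> Obj B; x \<in> Hom B Z (Fob L (Fob L A)); y \<in> Hom B Z (Fob L (Fob L A));
    Far L (\<iota> A) \<cdot> x = Far L (\<iota> A) \<cdot> y\<rbrakk> \<Longrightarrow> x = y"
  using L_mono[OF iota_hom iota_mono] .

lemma L_icomp_stage:
  assumes x: "x \<in> ielem B C Z X Y" and y: "y \<in> ielem B C Z Y W" and k: "k \<in> Hom B V (Fob L Z)"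
  shows "Far L (icomp B C x y) \<cdot> k = icomp B D (Far L x \<cdot> k) (Far L y \<cdot> k)"
  unfolding L_icomp[OF x y] by (rule cod.icomp_stage[OF L_ielem[OF x] L_ielem[OF y] k])

text \<open>Tested after the monomorphism \<box>\<iota>, where \<delta> becomes \<open>H\<close>. An
  element of \<box>A' in the image of \<box>f is a composite with the constant \<open>Ff\<close>;
  \<open>H\<close> preserves composition and, by \<open>har_const\<close>, respects that
  constant.\<close>

lemma delta_natural:
  assumes f: "f \<in> Hom B A A'"
  shows "\<delta> A' \<cdot> Far L f = Far L (Far L f) \<cdot> \<delta> A"
proof -
  have o: "A \<in> Obj B" "A' \<in> Obj B" using hom_objs[OF f] by auto
  note Lf = L_far(1)[OF f] and d = delta_hom[OF o(1)] and d' = delta_hom[OF o(2)] and LA = L_ob[OF o(1)]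
  note iA = hom_objectD(1)[OF iota_hom_object[OF o(1)]] and Ff = F_ar_stage[OF f LA]
    and Li = L_far(1)[OF iota_hom[OF o(2)]]
  show ?thesis
  proof (rule L_iota_mono[OF o(2) comp_hom[OF Lf d'] comp_hom[OF d L_far(1)[OF Lf]]])
    have "Far L (\<iota> A') \<cdot> \<delta> A' \<cdot> Far L f = Har H \<cdot> \<iota> A' \<cdot> Far L f"
      using reassoc[OF L_iota_delta[OF o(2)] d' Li iota_hom[OF o(2)] har_box Lf] by simp
    also have "\<dots> = icomp B D (Har H \<cdot> \<iota> A) (Har H \<cdot> Fa (Fob L A) f)"
      unfolding L_far(2)[OF f] by (rule har_icomp[OF iA Ff])
    also have "\<dots> = icomp B D (Far L (\<iota> A) \<cdot> \<delta> A) (Far L (Fa (Fob L A) f) \<cdot> \<delta> A)"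
      unfolding L_iota_delta[OF o(1)] har_const[OF f LA d] ..
    also have "\<dots> = Far L (\<iota> A' \<cdot> Far L f) \<cdot> \<delta> A"
      unfolding L_far(2)[OF f] L_icomp_stage[OF iA Ff d] ..
    also have "\<dots> = Far L (\<iota> A') \<cdot> Far L (Far L f) \<cdot> \<delta> A"
      using L_comp_ap[OF Lf iota_hom[OF o(2)] d] by simp
    finally show "Far L (\<iota> A') \<cdot> \<delta> A' \<cdot> Far L f = Far L (\<iota> A') \<cdot> Far L (Far L f) \<cdot> \<delta> A" .
  qed
qed

end

context geminal_category
begin

lemma har_coassoc: "Far L (Har H) \<cdot> Har H = \<delta> (iar C) \<cdot> Har H"
  using h_coassoc by (simp add: ifcomp_def app_ifun_def Hsharp_def)

text \<open>A subobject \<open>j\<close> of \<open>iar C\<close> on which \<open>H\<close> restricts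
  to \<open>c\<close> inherits co-associativity: after \<box>\<box>j, which is monic, naturality of
  \<delta> reduces the claim to the law for \<open>H\<close>. It serves both for \<box>A with its
  \<iota> and for the fixed point \<open>K\<close>.\<close>

lemma coalgebra_coassoc:
  assumes j: "j \<in> Hom B K (iar C)"
    and mono: "\<And>Z h k. \<lbrakk>h \<in> Hom B Z K; k \<in> Hom B Z K; j \<cdot> h = j \<cdot> k\<rbrakk> \<Longrightarrow> h = k"
    and c: "c \<in> Hom B K (Fob L K)" and jc: "Far L j \<cdot> c = Har H \<cdot> j"
  shows "\<delta> K \<cdot> c = Far L c \<cdot> c"
proof -
  have K: "K \<in> Obj B" using hom_objs[OF j] by simp
  note Lj = L_far(1)[OF j] and d = delta_hom[OF K] and Lc = L_far(1)[OF c] and LH = L_far(1)[OF har_box]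
    and di = delta_hom[OF iar_obj]
  note LLj = L_far(1)[OF Lj]
  show ?thesis
  proof (rule L_mono[OF Lj _ comp_hom[OF c d] comp_hom[OF c Lc]])
    show "h = k" if "h \<in> Hom B Z (Fob L K)" "k \<in> Hom B Z (Fob L K)" "Far L j \<cdot> h = Far L j \<cdot> k" for Z h k
      using L_mono[OF j mono that] .
    have "Far L (Far L j) \<cdot> \<delta> K \<cdot> c = \<delta> (iar C) \<cdot> Far L j \<cdot> c"
      using reassoc[OF delta_natural[OF j] Lj di d LLj c] by simp
    also have "\<dots> = Far L (Har H) \<cdot> Har H \<cdot> j"
      unfolding jc using reassoc[OF har_coassoc har_box LH har_box di j] by simp
    also have "\<dots> = Far L (Far L j \<cdot> c) \<cdot> c"
      unfolding jc[symmetric] using L_comp_ap[OF j har_box c] jc by simp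
    also have "\<dots> = Far L (Far L j) \<cdot> Far L c \<cdot> c"
      using L_comp_ap[OF c Lj c] by simp
    finally show "Far L (Far L j) \<cdot> \<delta> K \<cdot> c = Far L (Far L j) \<cdot> Far L c \<cdot> c" .
  qed
qed

lemma delta_coassoc:
  assumes A: "A \<in> Obj B"
  shows "\<delta> (Fob L A) \<cdot> \<delta> A = Far L (\<delta> A) \<cdot> \<delta> A"
  by (rule coalgebra_coassoc[OF iota_hom[OF A] iota_mono[OF A] delta_hom[OF A] L_iota_delta[OF A]])

end

section \<open>The fixed-point operator\<close>

text \<open>Pulling back along a global element yields a monomorphism, since the other leg goes to
  \<open>1\<close>. It carves out arrows with a prescribed codomain, and the fibre in the diagonal
  step.\<close>

lemma (in lex_category) fibre:
  assumes f: "f \<in> Hom B M N" and X: "X \<in> Hom B (One B) N"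
  defines "p \<equiv> Pb1 B f X" and "P \<equiv> Dom B (Pb1 B f X)"
  shows "p \<in> Hom B P M"
    and "f \<cdot> p = X \<cdot> bang B P"
    and "\<lbrakk>x \<in> Hom B Z M; f \<cdot> x = X \<cdot> bang B Z\<rbrakk> \<Longrightarrow> \<exists>h. h \<in> Hom B Z P \<and> p \<cdot> h = x"
    and "\<lbrakk>h \<in> Hom B Z P; k \<in> Hom B Z P; p \<cdot> h = p \<cdot> k\<rbrakk> \<Longrightarrow> h = k"
proof -
  have d: "f \<in> Arr B" "X \<in> Arr B" "Cod B f = Cod B X" "Dom B f = M" "Dom B X = One B"
    using f X by (simp_all add: Hom_def)
  note pb = pb_pullback[OF d(1-3)]
  note D = is_pullbackD[OF pb, unfolded d(4,5), folded p_def P_def]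
  show "p \<in> Hom B P M" by (rule D(1))
  show "f \<cdot> p = X \<cdot> bang B P" using D(3) bang_eq[OF D(2)] by simp
  show "\<exists>h. h \<in> Hom B Z P \<and> p \<cdot> h = x" if x: "x \<in> Hom B Z M" and e: "f \<cdot> x = X \<cdot> bang B Z"
    using lift_props[OF pb _ _ e, unfolded d(4,5), folded p_def P_def, OF x bang_hom] hom_objs[OF x] by blast
  show "h = k" if h: "h \<in> Hom B Z P" and k: "k \<in> Hom B Z P" and e: "p \<cdot> h = p \<cdot> k"
    by (rule pullback_unique[OF pb, folded p_def P_def, OF h k e to_one_unique[OF comp_hom[OF h D(2)] comp_hom[OF k D(2)]]])
qed

text \<open>Products are pullbacks over \<open>1\<close>, and the compatibility condition holds
  automatically because \<open>F1\<close> is terminal in \<open>C\<close>.\<close>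

lemma (in internal_lex_model) F_prd_ex1:
  assumes X: "X \<in> Obj B" and Y: "Y \<in> Obj B"
    and x: "x \<in> ielem B C Z U (Fo Z X)" and y: "y \<in> ielem B C Z U (Fo Z Y)"
  shows "\<exists>!h. h \<in> ielem B C Z U (Fo Z (Prd B X Y)) \<and> h \<star> Fa Z (Pr1 B X Y) = x \<and> h \<star> Fa Z (Pr2 B X Y) = y"
proof -
  have Z: "Z \<in> Obj B" using hom_objs[OF ielemD(1)[OF x]] by simp
  have "x \<star> Fa Z (bang B X) = y \<star> Fa Z (bang B Y)"
    using icomp_ielem[OF x F_ar_stage[OF bang_hom[OF X] Z]] icomp_ielem[OF y F_ar_stage[OF bang_hom[OF Y] Z]]
    by (intro to_itrm_unique) (simp_all add: F_one)
  from F_pb_ex1[OF bang_hom[OF X] bang_hom[OF Y] x y this]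
  show ?thesis by (simp add: Pr1_def Pr2_def Prd_def)
qed

lemma (in internal_lex_model) prod_iso_props:
  assumes X: "X \<in> Obj B" and Y: "Y \<in> Obj B"
  shows "prod_iso B B L X Y \<in> Hom B (Prd B (Fob L X) (Fob L Y)) (Fob L (Prd B X Y))"
    and "Far L (Pr1 B X Y) \<cdot> prod_iso B B L X Y = Pr1 B (Fob L X) (Fob L Y)"
    and "Far L (Pr2 B X Y) \<cdot> prod_iso B B L X Y = Pr2 B (Fob L X) (Fob L Y)"
proof -
  let ?Q = "Prd B (Fob L X) (Fob L Y)" and ?P = "Fob L (Prd B X Y)"
  note LX = L_ob[OF X] and LY = L_ob[OF Y] and b = bang_hom[OF X] bang_hom[OF Y]
  note pb = L_pullback[OF prod_pullback[OF X Y]] and pr = pr_hom[OF X Y] and qr = pr_hom[OF LX LY]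
  note Lp = L_far(1)[OF pr(1)] L_far(1)[OF pr(2)]
  have d: "Dom B (Far L (bang B X)) = Fob L X" "Dom B (Far L (bang B Y)) = Fob L Y"
    "Dom B (Far L (Pr1 B X Y)) = ?P"
    using L_far(1)[OF b(1)] L_far(1)[OF b(2)] Lp by (simp_all add: Hom_def)
  have eq: "Far L (bang B X) \<cdot> Pr1 B (Fob L X) (Fob L Y) = Far L (bang B Y) \<cdot> Pr2 B (Fob L X) (Fob L Y)"
    by (rule to_L_one_unique[OF comp_hom[OF qr(1) L_far(1)[OF b(1)]] comp_hom[OF qr(2) L_far(1)[OF b(2)]]])
  obtain k where k: "k \<in> Hom B ?Q ?P" "Far L (Pr1 B X Y) \<cdot> k = Pr1 B (Fob L X) (Fob L Y)"
    "Far L (Pr2 B X Y) \<cdot> k = Pr2 B (Fob L X) (Fob L Y)"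
    using lift_props[OF pb _ _ eq, unfolded d, OF qr] by blast
  note m = pair_props[OF Lp]
  let ?m = "pair B (Far L (Pr1 B X Y)) (Far L (Pr2 B X Y))"
  have mk: "?m \<cdot> k = Id B ?Q"
    by (rule prd_unique[OF comp_hom[OF k(1) m(1)] id_hom[OF prd_obj[OF LX LY]] LX LY])
      (use comp_assoc[OF k(1) m(1) qr(1)] comp_assoc[OF k(1) m(1) qr(2)] m k id_right[OF qr(1)] id_right[OF qr(2)]
        in simp_all)
  have km: "k \<cdot> ?m = Id B ?P"
    by (rule pullback_unique[OF pb, unfolded d, OF comp_hom[OF m(1) k(1)] id_hom[OF L_ob[OF prd_obj[OF X Y]]]])
      (use comp_assoc[OF m(1) k(1) Lp(1)] comp_assoc[OF m(1) k(1) Lp(2)] m k id_right[OF Lp(1)] id_right[OF Lp(2)]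
        in simp_all)
  have iso: "is_iso B k" using k(1) m(1) mk km by (auto simp: is_iso_def Hom_def)
  have "\<exists>!k. k \<in> Hom B ?Q ?P \<and> is_iso B k \<and>
      Far L (Pr1 B X Y) \<cdot> k = Pr1 B (Fob L X) (Fob L Y) \<and> Far L (Pr2 B X Y) \<cdot> k = Pr2 B (Fob L X) (Fob L Y)"
  proof (rule ex1I[of _ k])
    fix l
    assume l: "l \<in> Hom B ?Q ?P \<and> is_iso B l \<and>
      Far L (Pr1 B X Y) \<cdot> l = Pr1 B (Fob L X) (Fob L Y) \<and> Far L (Pr2 B X Y) \<cdot> l = Pr2 B (Fob L X) (Fob L Y)"
    show "l = k" by (rule pullback_unique[OF pb, unfolded d, of l ?Q k]) (use l k in simp_all)
  qed (use k iso in blast)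
  from theI'[OF this]
  show "prod_iso B B L X Y \<in> Hom B ?Q ?P"
    "Far L (Pr1 B X Y) \<cdot> prod_iso B B L X Y = Pr1 B (Fob L X) (Fob L Y)"
    "Far L (Pr2 B X Y) \<cdot> prod_iso B B L X Y = Pr2 B (Fob L X) (Fob L Y)"
    unfolding prod_iso_def by blast+
qed

section \<open>Codes of arrows and the diagonal construction\<close>

context pre_geminal_category
begin

text \<open>
  Viewed as an arrow of \<open>C\<close>, \<open>Har H \<cdot> x\<close> is a morphism \<open>1 \<rightarrow> F (iar C)\<close>: the code of \<open>x\<close>.
\<close>

abbreviation code :: "'m \<Rightarrow> 'm" where "code x \<equiv> \<iota> (iar C) \<cdot> (Har H \<cdot> x)"

lemma code_ielem:
  "x \<in> Hom B Z (iar C) \<Longrightarrow> code x \<in> ielem B C Z (itrm C \<cdot> bang B Z) (Fo Z (iar C))"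
  by (rule iota_elem[OF iar_obj comp_hom[OF _ har_box]])

lemma code_stage:
  assumes x: "x \<in> Hom B Z (iar C)" and k: "k \<in> Hom B W Z"
  shows "code x \<cdot> k = code (x \<cdot> k)"
  unfolding comp_assoc[OF k comp_hom[OF x har_box] iota_hom[OF iar_obj]] comp_assoc[OF k x har_box] ..

text \<open>The source of self-reference. The arrow \<open>Fe\<close> of \<open>C\<close> is also a
  morphism \<open>1\<close> \<rightarrow> \<open>iar C\<close> of \<open>B\<close>, to which
  \<open>F\<close> applies again. \<open>H\<close> sends \<open>Fe\<close> to
  \<box>(\<open>Fe\<close>) after \<open>1\<close> \<cong> \<box>1, and read in \<open>C\<close>
  this is \<open>F(Fe)\<close>.\<close>

lemma code_F:
  assumes e: "e \<in> Hom B E A" and Z: "Z \<in> Obj B"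
  shows "code (Fa Z e) = Fa Z (Far F e)"
proof -
  have q: "Far F e \<in> Hom B (One B) (iar C)" using ielemD(1)[OF F_ar[OF e]] .
  note b = bang_hom[OF Z]
  note u = comp_hom[OF b one_iso_hom]
  have "e \<in> Arr B" using e by (simp add: Hom_def)
  then have "Har H \<cdot> Fa Z e = Far L (Far F e) \<cdot> (one_iso B B L \<cdot> bang B Z)"
    using comp_assoc[OF b q har_box] h_far comp_assoc[OF b one_iso_hom L_far(1)[OF q]] by (simp add: sharp_def)
  then have *: "code (Fa Z e) = (\<iota> (One B) \<cdot> (one_iso B B L \<cdot> bang B Z)) \<star> Fa Z (Far F e)"
    using L_far_elem[OF q u] by simp
  \<comment> \<open>Read in \<open>C\<close>, the canonical element of \<box>1 is an arrow
    \<open>1\<close> \<rightarrow> \<open>1\<close>, hence the identity.\<close>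
  have "\<iota> (One B) \<cdot> (one_iso B B L \<cdot> bang B Z) = iid C \<cdot> Fo Z (One B)"
    using iota_elem[OF one_obj u] iid_ielem[OF comp_hom[OF b itrm_hom]] unfolding F_one
    by (rule to_itrm_unique)
  then show ?thesis
    unfolding * using icomp_iid_left[OF F_ar_stage[OF q Z]] by simp
qed

text \<open>\<open>V\<close> consists of the arrows into \<open>F(iar C)\<close>, \<open>T\<close>
  of the arrows into \<open>FA\<close>, and \<open>E\<close> of the pairs of \<open>x\<close> in
  \<open>V\<close> and an arrow \<open>W x\<close> \<rightarrow> \<open>FA\<close>; \<open>e\<close>
  sends a pair to \<open>x\<close>. The arrow \<open>q\<close> = \<open>Fe\<close> is itself in
  \<open>V\<close>, and its code is \<open>Fq\<close>, so \<open>W q\<close> is the pullback of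
  \<open>Fe\<close> and \<open>Fq\<close>. By strictness this is \<open>FK\<close> for the fibre
  \<open>K\<close> of \<open>e\<close> over \<open>q\<close>. But that fibre consists of the arrows
  \<open>W q\<close> \<rightarrow> \<open>FA\<close>, that is, of the arrows \<open>FK\<close>
  \<rightarrow> \<open>FA\<close>.\<close>

lemma fixed_hom_object:
  assumes A: "A \<in> Obj B"
  obtains K j where "K \<in> Obj B" "hom_object B C K (Fob F K) (Fob F A) j"
proof -
  let ?I = "iar C"
  note FI = F_ob[OF iar_obj] and FA = F_ob[OF A]
  define v where "v = Pb1 B (icod C) (Fob F ?I)"
  define V where "V = Dom B (Pb1 B (icod C) (Fob F ?I))"
  note v = fibre(1,2)[OF icod_hom FI, folded v_def V_def]
    and v_ex = fibre(3)[OF icod_hom FI, folded v_def V_def]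
    and v_mono = fibre(4)[OF icod_hom FI, folded v_def V_def]
  define t where "t = Pb1 B (icod C) (Fob F A)"
  define T where "T = Dom B (Pb1 B (icod C) (Fob F A))"
  note t = fibre(1,2)[OF icod_hom FA, folded t_def T_def]
    and t_ex = fibre(3)[OF icod_hom FA, folded t_def T_def]
    and t_mono = fibre(4)[OF icod_hom FA, folded t_def T_def]
  \<comment> \<open>The pullback of an arrow \<open>x\<close> into \<open>F(iar C)\<close> along its
    own code, as a family over all such \<open>x\<close>.\<close>
  define W where "W = iapex v (code v)"
  have vel: "v \<in> ielem B C V (idom C \<cdot> v) (Fo V ?I)" using v by (simp add: ielem_def)
  note cel = code_ielem[OF v(1)]
  have W: "W \<in> Hom B V (iob C)" unfolding W_def using ielem_ends(1)[OF ileg_ielem(1)[OF vel cel]] .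
  have W_stage: "W \<cdot> y = iapex (v \<cdot> y) (code (v \<cdot> y))" if y: "y \<in> Hom B Z V" for Z y
    unfolding W_def comp_assoc[OF y ielemD(1)[OF ileg_ielem(1)[OF vel cel]] idom_hom]
      ileg_stage(1)[OF vel cel y] code_stage[OF v(1) y] ..
  note dt = comp_hom[OF t(1) idom_hom]
  let ?e1 = "Pb1 B W (idom C \<cdot> t)" and ?e2 = "Pb2 B W (idom C \<cdot> t)"
  define E where "E = Dom B ?e1"
  have Wd: "W \<in> Arr B" "idom C \<cdot> t \<in> Arr B" "Cod B W = Cod B (idom C \<cdot> t)" "Dom B W = V" "Dom B (idom C \<cdot> t) = T"
    using W dt by (simp_all add: Hom_def)
  note pbE = pb_pullback[OF Wd(1-3)]
  note PE = is_pullbackD[OF pbE, unfolded Wd(4,5), folded E_def]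
  define e where "e = v \<cdot> ?e1"
  have e: "e \<in> Hom B E ?I" unfolding e_def by (rule comp_hom[OF PE(1) v(1)])
  \<comment> \<open>Two levels meet: the \<open>C\<close>-arrow \<open>Fe\<close> is taken as a
    point of the codomain of \<open>e\<close>.\<close>
  define q where "q = Far F e"
  have qel: "q \<in> ielem B C (One B) (Fob F E) (Fob F ?I)" unfolding q_def by (rule F_ar[OF e])
  note q = ielemD(1)[OF qel]
  define k where "k = Pb1 B e q"
  define K where "K = Dom B (Pb1 B e q)"
  note k = fibre(1,2)[OF e q, folded k_def K_def]
    and k_ex = fibre(3)[OF e q, folded k_def K_def]
    and k_mono = fibre(4)[OF e q, folded k_def K_def]
  have K: "K \<in> Obj B" using hom_objs[OF k(1)] by simp
  \<comment> \<open>The diagonal step: at the code of \<open>F e\<close> itself the family \<open>W\<close> takes the value \<open>F K\<close>.\<close>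
  have diag: "W \<cdot> y = Fo Z K" if y: "y \<in> Hom B Z V" and vy: "v \<cdot> y = q \<cdot> bang B Z" for Z y
  proof -
    have Z: "Z \<in> Obj B" using hom_objs[OF y] by simp
    show ?thesis
      unfolding W_stage[OF y] vy unfolding q_def code_F[OF e Z]
      using F_pb_stage(3)[OF e q Z, folded K_def] by (simp add: q_def)
  qed
  \<comment> \<open>Only the second component of a pair is kept; on \<open>K\<close> the first is
    constantly \<open>q\<close>.\<close>
  let ?j = "t \<cdot> (?e2 \<cdot> k)"
  note e2k = comp_hom[OF k(1) PE(2)] and e1k = comp_hom[OF k(1) PE(1)]
  have ve1: "v \<cdot> (?e1 \<cdot> x) = e \<cdot> x" if "x \<in> Hom B Z E" for Z x
    unfolding e_def using comp_assoc[OF that PE(1) v(1)] by simp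
  have cd: "icod C \<cdot> (t \<cdot> y) = Fo Z A" if "y \<in> Hom B Z T" for Z y
    using comp_assoc[OF that t(1) icod_hom] t(2) F_const[OF A that] by simp
  have "?j \<in> ielem B C K (Fo K K) (Fo K A)"
  proof -
    have "idom C \<cdot> ?j = W \<cdot> (?e1 \<cdot> k)"
      using comp_assoc[OF e2k t(1) idom_hom] reassoc[OF PE(3) PE(1) W PE(2) dt k(1)] by simp
    also have "\<dots> = Fo K K" using diag[OF e1k] ve1[OF k(1)] k(2) by simp
    finally show ?thesis using cd[OF e2k] comp_hom[OF e2k t(1)] by (simp add: ielem_def)
  qed
  moreover have "\<exists>!h. h \<in> Hom B Z K \<and> ?j \<cdot> h = x" if x: "x \<in> ielem B C Z (Fo Z K) (Fo Z A)" for Z x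
  proof (rule ex_ex1I)
    have Z: "Z \<in> Obj B" using hom_objs[OF ielemD(1)[OF x]] by simp
    note b = bang_hom[OF Z]
    have jh: "?j \<cdot> h = t \<cdot> (?e2 \<cdot> (k \<cdot> h))" if h: "h \<in> Hom B Z K" for h
      using comp_assoc[OF h e2k t(1)] comp_assoc[OF h k(1) PE(2)] by simp
    \<comment> \<open>An arrow \<open>x\<close> : \<open>FK\<close> \<rightarrow> \<open>FA\<close>
      at stage \<open>Z\<close> is completed to an element of \<open>E\<close> by the constant first
      component \<open>q\<close>, given by \<open>y\<close>.\<close>
    have "icod C \<cdot> (q \<cdot> bang B Z) = Fo Z ?I"
      using comp_assoc[OF b q icod_hom] ielemD(3)[OF qel] by simp
    then obtain y where y: "y \<in> Hom B Z V" "v \<cdot> y = q \<cdot> bang B Z"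
      using v_ex[OF comp_hom[OF b q]] by blast
    obtain z where z: "z \<in> Hom B Z T" "t \<cdot> z = x"
      using t_ex[OF ielemD(1)[OF x] ielemD(3)[OF x]] by blast
    have eq: "W \<cdot> y = (idom C \<cdot> t) \<cdot> z"
      using diag[OF y] comp_assoc[OF z(1) t(1) idom_hom] z(2) ielemD(2)[OF x] by simp
    obtain w where w: "w \<in> Hom B Z E" "?e1 \<cdot> w = y" "?e2 \<cdot> w = z"
      using lift_props[OF pbE _ _ eq, unfolded Wd(4,5), folded E_def, OF y(1) z(1)] by blast
    have "e \<cdot> w = q \<cdot> bang B Z" using ve1[OF w(1)] w(2) y(2) by simp
    then obtain h where "h \<in> Hom B Z K" "k \<cdot> h = w" using k_ex[OF w(1)] by blast
    then show "\<exists>h. h \<in> Hom B Z K \<and> ?j \<cdot> h = x" using jh w(3) z(2) by auto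
    fix h l
    assume "h \<in> Hom B Z K \<and> ?j \<cdot> h = x" "l \<in> Hom B Z K \<and> ?j \<cdot> l = x"
    then have h: "h \<in> Hom B Z K" and l: "l \<in> Hom B Z K" and hl: "?j \<cdot> h = ?j \<cdot> l" by auto
    note kh = comp_hom[OF h k(1)] and kl = comp_hom[OF l k(1)]
    \<comment> \<open>Two elements of \<open>K\<close> share the first component \<open>q\<close>,
      so equality of second components suffices.\<close>
    have "e \<cdot> (k \<cdot> g) = q \<cdot> bang B Z" if g: "g \<in> Hom B Z K" for g
      using comp_assoc[OF g k(1) e] k(2) const_comp[OF q g] by simp
    then have "v \<cdot> (?e1 \<cdot> (k \<cdot> h)) = v \<cdot> (?e1 \<cdot> (k \<cdot> l))"
      unfolding ve1[OF kh] ve1[OF kl] using h l by simp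
    then have 1: "?e1 \<cdot> (k \<cdot> h) = ?e1 \<cdot> (k \<cdot> l)"
      by (rule v_mono[OF comp_hom[OF kh PE(1)] comp_hom[OF kl PE(1)]])
    have 2: "?e2 \<cdot> (k \<cdot> h) = ?e2 \<cdot> (k \<cdot> l)"
      by (rule t_mono[OF comp_hom[OF kh PE(2)] comp_hom[OF kl PE(2)]]) (use hl jh[OF h] jh[OF l] in simp)
    show "h = l"
      by (rule k_mono[OF h l pullback_unique[OF pbE, folded E_def, OF kh kl 1 2]])
  qed
  ultimately have "hom_object B C K (Fob F K) (Fob F A) ?j" unfolding hom_object_def by blast
  with K that show thesis by blast
qed

end

section \<open>The internal Loeb argument\<close>

context geminal_category
begin

text \<open>With \<open>g\<close> the generic arrow \<open>F\<close>\<box>A \<rightarrow>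
  \<open>FA\<close>, put \<open>a\<close> = \<open>g\<close> \<circ> \<open>Fd\<close> in
  \<open>K\<close> and \<open>y\<close> = \<open>d a\<close>. Then \<open>d a\<close> =
  \<open>a\<close> \<circ> \<open>c a\<close> = \<open>g\<close> \<circ> \<open>Fd\<close> \<circ>
  \<open>c a\<close>, and \<open>Fd\<close> \<circ> \<open>c a\<close> is \<box>d applied to
  \<open>c a\<close>, which is \<delta>(\<open>d a\<close>) because \<open>d\<close> is a coalgebra
  morphism.\<close>

lemma loeb:
  assumes A: "A \<in> Obj B"
  defines "G \<equiv> ihom B C (Fob F (Fob L A)) (Fob F A)" and "g \<equiv> ihom_incl B C (Fob F (Fob L A)) (Fob F A)"
  obtains y where "y \<in> Hom B G (Fob L A)" "\<iota> A \<cdot> y = (\<iota> (Fob L A) \<cdot> (\<delta> A \<cdot> y)) \<star> g"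
proof -
  note LA = L_ob[OF A] and FA = F_ob[OF A] and dA = delta_hom[OF A] and iA = iota_hom[OF A]
  note FLA = F_ob[OF LA]
  have g: "hom_object B C G (Fob F (Fob L A)) (Fob F A) g"
    unfolding G_def g_def by (rule ihom_object(1)[OF FLA FA])
  note gel = hom_objectD(1)[OF g] and gh = hom_objectD(2)[OF g]
  have G: "G \<in> Obj B" using hom_objs[OF gh] by simp
  obtain K j where K: "K \<in> Obj B" and j: "hom_object B C K (Fob F K) (Fob F A) j"
    using fixed_hom_object[OF A] .
  note FK = F_ob[OF K] and jel = hom_objectD(1)[OF j] and jh = hom_objectD(2)[OF j]
  note iK = iota_hom[OF K] and b = bang_hom[OF K] and Lj = L_far(1)[OF jh]
  note LiK = L_far(1)[OF iK] and LiA = L_far(1)[OF iA] and dK = delta_hom[OF K]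
  \<comment> \<open>\<open>H\<close> turns an arrow \<open>FK\<close> \<rightarrow>
    \<open>FA\<close> of \<open>C\<close> into one of \<box>C with ends \<box>#(\<open>FK\<close>)
    and \<box>#(\<open>FA\<close>), which is an element of \<box>K.\<close>
  have "Har H \<cdot> j \<in> ielem B D K (sharp B B L (Fob F K) \<cdot> bang B K) (sharp B B L (Fob F A) \<cdot> bang B K)"
    using har_ielem[OF jel] comp_assoc[OF b FK hob] comp_assoc[OF b FA hob] h_fob[OF K] h_fob[OF A] by simp
  then obtain c where c: "c \<in> Hom B K (Fob L K)" "Far L j \<cdot> c = Har H \<cdot> j"
    by (rule cod.hom_object_factor[OF L_hom_object[OF j FK FA]])
  note Lc = L_far(1)[OF c(1)]
  have cc: "\<delta> K \<cdot> c = Far L c \<cdot> c"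
    by (rule coalgebra_coassoc[OF jh hom_object_mono[OF j FK FA] c])
  note ic = iota_elem[OF K c(1)]
  \<comment> \<open>Self-application: \<open>k\<close> is an arrow out of \<open>FK\<close>, and
    \<open>c k\<close> is an arrow \<open>1\<close> \<rightarrow> \<open>FK\<close>.\<close>
  obtain d where d: "d \<in> Hom B K (Fob L A)" "\<iota> A \<cdot> d = (\<iota> K \<cdot> c) \<star> j"
    using iota_ex1[OF A icomp_ielem[OF ic jel]] by blast
  note Ld = L_far(1)[OF d(1)]
  \<comment> \<open>\<open>d\<close> is a coalgebra morphism: after \<box>\<iota>A both sides become
    \<open>H\<close> of the composite \<open>k\<close> \<circ> \<open>c k\<close>, where
    co-associativity of \<open>c\<close> handles the inner factor.\<close>
  have Ldc: "Far L d \<cdot> c = \<delta> A \<cdot> d"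
  proof (rule L_iota_mono[OF A comp_hom[OF c(1) Ld] comp_hom[OF d(1) dA]])
    have "Far L (\<iota> A) \<cdot> (Far L d \<cdot> c) = Far L ((\<iota> K \<cdot> c) \<star> j) \<cdot> c"
      using L_comp_ap[OF d(1) iA c(1)] d(2) by simp
    also have "\<dots> = icomp B D (Far L (\<iota> K \<cdot> c) \<cdot> c) (Far L j \<cdot> c)"
      by (rule L_icomp_stage[OF ic jel c(1)])
    also have "Far L (\<iota> K \<cdot> c) \<cdot> c = Far L (\<iota> K) \<cdot> (\<delta> K \<cdot> c)"
      using L_comp_ap[OF c(1) iK c(1)] cc by simp
    also have "\<dots> = Har H \<cdot> (\<iota> K \<cdot> c)"
      by (rule reassoc[OF L_iota_delta[OF K] dK LiK iK har_box c(1)])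
    also have "icomp B D (Har H \<cdot> (\<iota> K \<cdot> c)) (Far L j \<cdot> c) = Har H \<cdot> (\<iota> A \<cdot> d)"
      unfolding c(2) d(2) by (rule har_icomp[OF ic jel, symmetric])
    also have "\<dots> = Far L (\<iota> A) \<cdot> (\<delta> A \<cdot> d)"
      by (rule reassoc[OF L_iota_delta[OF A] dA LiA iA har_box d(1), symmetric])
    finally show "Far L (\<iota> A) \<cdot> (Far L d \<cdot> c) = Far L (\<iota> A) \<cdot> (\<delta> A \<cdot> d)" .
  qed
  note Fd = F_ar_stage[OF d(1) G]
  \<comment> \<open>Precomposition with \<open>Fd\<close> moves from arrows out of
    \<open>F\<close>\<box>A to arrows out of \<open>FK\<close>.\<close>
  obtain a where a: "a \<in> Hom B G K" "j \<cdot> a = Fa G d \<star> g"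
    using hom_object_factor[OF j icomp_ielem[OF Fd gel]] .
  note ca = comp_hom[OF a(1) c(1)] and da = comp_hom[OF a(1) d(1)]
  have "\<iota> A \<cdot> (d \<cdot> a) = ((\<iota> K \<cdot> c) \<star> j) \<cdot> a"
    using comp_assoc[OF a(1) d(1) iA] d(2) by simp
  also have "\<dots> = (\<iota> K \<cdot> (c \<cdot> a)) \<star> (Fa G d \<star> g)"
    using icomp_stage[OF ic jel a(1)] comp_assoc[OF a(1) c(1) iK] a(2) by simp
  also have "\<dots> = ((\<iota> K \<cdot> (c \<cdot> a)) \<star> Fa G d) \<star> g"
    by (rule icomp_assoc[OF iota_elem[OF K ca] Fd gel, symmetric])
  also have "(\<iota> K \<cdot> (c \<cdot> a)) \<star> Fa G d = \<iota> (Fob L A) \<cdot> (Far L d \<cdot> (c \<cdot> a))"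
    by (rule L_far_elem[OF d(1) ca, symmetric])
  also have "Far L d \<cdot> (c \<cdot> a) = \<delta> A \<cdot> (d \<cdot> a)"
    by (rule reassoc[OF Ldc c(1) Ld d(1) dA a(1)])
  finally show thesis using that[OF da] by simp
qed

end

section \<open>Partial application of a morphism out of a product\<close>

context internal_lex_model
begin

text \<open>For the generic \<open>b\<close> : \<open>1\<close> \<rightarrow> \<open>FX\<close>,
  this is the arrow \<langle>b \<circ> !, id\<rangle> from \<open>FY\<close> to \<open>F(X\<close>
  \<times> \<open>Y)\<close>, as a family over \<box>X.\<close>

definition point_pairing :: "'o \<Rightarrow> 'o \<Rightarrow> 'm" where
  "point_pairing X Y = (THE h. h \<in> ielem B C (Fob L X) (Fo (Fob L X) Y) (Fo (Fob L X) (Prd B X Y)) \<and>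
    h \<star> Fa (Fob L X) (Pr1 B X Y) = (ibang C \<cdot> Fo (Fob L X) Y) \<star> \<iota> X \<and>
    h \<star> Fa (Fob L X) (Pr2 B X Y) = iid C \<cdot> Fo (Fob L X) Y)"

lemma point_pairing:
  assumes X: "X \<in> Obj B" and Y: "Y \<in> Obj B"
  shows "point_pairing X Y \<in> ielem B C (Fob L X) (Fo (Fob L X) Y) (Fo (Fob L X) (Prd B X Y))"
    and "point_pairing X Y \<star> Fa (Fob L X) (Pr1 B X Y) = (ibang C \<cdot> Fo (Fob L X) Y) \<star> \<iota> X"
    and "point_pairing X Y \<star> Fa (Fob L X) (Pr2 B X Y) = iid C \<cdot> Fo (Fob L X) Y"
proof -
  note FY = F_ob_stage[OF Y L_ob[OF X]]
  note t = theI'[OF F_prd_ex1[OF X Y icomp_ielem[OF ibang_ielem[OF FY] hom_objectD(1)[OF iota_hom_object[OF X]]]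
      iid_ielem[OF FY]], folded point_pairing_def]
  show "point_pairing X Y \<in> ielem B C (Fob L X) (Fo (Fob L X) Y) (Fo (Fob L X) (Prd B X Y))"
    "point_pairing X Y \<star> Fa (Fob L X) (Pr1 B X Y) = (ibang C \<cdot> Fo (Fob L X) Y) \<star> \<iota> X"
    "point_pairing X Y \<star> Fa (Fob L X) (Pr2 B X Y) = iid C \<cdot> Fo (Fob L X) Y"
    using t by auto
qed

text \<open>Currying inside \<open>C\<close>: \<open>b\<close> in \<box>X goes to the arrow
  \<open>Ff\<close> \<circ> \<langle>b \<circ> !, id\<rangle> of \<open>C(FY, FA)\<close>.\<close>

definition partial_app :: "'o \<Rightarrow> 'o \<Rightarrow> 'o \<Rightarrow> 'm \<Rightarrow> 'm" where
  "partial_app X Y A f =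
    ihom_lift B C (Fob F Y) (Fob F A) (point_pairing X Y \<star> Fa (Fob L X) f)"

lemma partial_app:
  assumes X: "X \<in> Obj B" and Y: "Y \<in> Obj B" and f: "f \<in> Hom B (Prd B X Y) A"
  shows "partial_app X Y A f \<in> Hom B (Fob L X) (ihom B C (Fob F Y) (Fob F A))"
    and "ihom_incl B C (Fob F Y) (Fob F A) \<cdot> partial_app X Y A f = point_pairing X Y \<star> Fa (Fob L X) f"
  using ihom_lift[OF F_ob[OF Y] F_ob icomp_ielem[OF point_pairing(1)[OF X Y] F_ar_stage[OF f L_ob[OF X]]]]
    hom_objs[OF f] by (simp_all add: partial_app_def)

lemma partial_app_natural:
  assumes X: "X \<in> Obj B" and Y: "Y \<in> Obj B" and f: "f \<in> Hom B (Prd B X Y) A" and g: "g \<in> Hom B X' X"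
  shows "partial_app X' Y A (f \<cdot> prod_map B g (Id B Y)) = partial_app X Y A f \<cdot> Far L g"
proof -
  have X': "X' \<in> Obj B" and A: "A \<in> Obj B" using hom_objs[OF g] hom_objs[OF f] by auto
  let ?Z = "Fob L X'" and ?W = "Fob L X"
  have Z: "?Z \<in> Obj B" and W: "?W \<in> Obj B" using L_ob X X' by auto
  note pr' = pr_hom[OF X' Y] and pr = pr_hom[OF X Y] and iY = id_hom[OF Y] and Lg = L_far(1)[OF g]
  have d: "Dom B g = X'" using g by (simp add: Hom_def)
  define m where "m = prod_map B g (Id B Y)"
  have m: "m \<in> Hom B (Prd B X' Y) (Prd B X Y)" "Pr1 B X Y \<cdot> m = g \<cdot> Pr1 B X' Y" "Pr2 B X Y \<cdot> m = Pr2 B X' Y"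
    using pair_props[OF comp_hom[OF pr'(1) g] comp_hom[OF pr'(2) iY]] id_left[OF pr'(2)] d Y
    by (simp_all add: m_def prod_map_def)
  note p = point_pairing[OF X Y] and p' = point_pairing[OF X' Y]
  note Fm = F_ar_stage[OF m(1) Z] and Ff = F_ar_stage[OF f Z] and Fg = F_ar_stage[OF g Z]
  note i' = hom_objectD(1)[OF iota_hom_object[OF X']] and i = hom_objectD(1)[OF iota_hom_object[OF X]]
  note bg = ibang_ielem[OF F_ob_stage[OF Y Z]] and bg' = ibang_ielem[OF F_ob_stage[OF Y W]]
  have stage: "point_pairing X Y \<cdot> Far L g \<in> ielem B C ?Z (Fo ?Z Y) (Fo ?Z (Prd B X Y))"
    using ielem_stage[OF p(1) Lg] F_const[OF Y Lg] F_const[OF prd_obj[OF X Y] Lg] by simp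
  \<comment> \<open>\<langle>b \<circ> !, id\<rangle> followed by \<open>F(g\<close> \<times>
    \<open>id)\<close> is the pairing at the point \<open>Fg\<close> \<circ> \<open>b\<close>: both
    have the same components.\<close>
  have pm: "point_pairing X' Y \<star> Fa ?Z m = point_pairing X Y \<cdot> Far L g"
  proof -
    have 1: "(point_pairing X' Y \<star> Fa ?Z m) \<star> Fa ?Z (Pr1 B X Y) = (ibang C \<cdot> Fo ?Z Y) \<star> (\<iota> X \<cdot> Far L g)"
    proof -
      have "(point_pairing X' Y \<star> Fa ?Z m) \<star> Fa ?Z (Pr1 B X Y) = point_pairing X' Y \<star> Fa ?Z (g \<cdot> Pr1 B X' Y)"
        using icomp_assoc[OF p'(1) Fm F_ar_stage[OF pr(1) Z]] F_comp_stage[OF m(1) pr(1) Z] m(2) by simp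
      also have "\<dots> = (point_pairing X' Y \<star> Fa ?Z (Pr1 B X' Y)) \<star> Fa ?Z g"
        using icomp_assoc[OF p'(1) F_ar_stage[OF pr'(1) Z] Fg] F_comp_stage[OF pr'(1) g Z] by simp
      also have "\<dots> = (ibang C \<cdot> Fo ?Z Y) \<star> (\<iota> X' \<star> Fa ?Z g)"
        unfolding p'(2) by (rule icomp_assoc[OF bg i' Fg])
      finally show ?thesis unfolding L_far(2)[OF g] .
    qed
    have 2: "(point_pairing X' Y \<star> Fa ?Z m) \<star> Fa ?Z (Pr2 B X Y) = iid C \<cdot> Fo ?Z Y"
      using icomp_assoc[OF p'(1) Fm F_ar_stage[OF pr(2) Z]] F_comp_stage[OF m(1) pr(2) Z] m(3) p'(3) by simp
    have 3: "(point_pairing X Y \<cdot> Far L g) \<star> Fa ?Z (Pr1 B X Y) = (ibang C \<cdot> Fo ?Z Y) \<star> (\<iota> X \<cdot> Far L g)"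
    proof -
      have "(point_pairing X Y \<cdot> Far L g) \<star> Fa ?Z (Pr1 B X Y) = ((ibang C \<cdot> Fo ?W Y) \<star> \<iota> X) \<cdot> Far L g"
        using icomp_stage[OF p(1) F_ar_stage[OF pr(1) W] Lg] Fa_const[OF pr(1) Lg] p(2) by simp
      also have "\<dots> = (ibang C \<cdot> Fo ?Z Y) \<star> (\<iota> X \<cdot> Far L g)"
        using icomp_stage[OF bg' i Lg] comp_assoc[OF Lg F_ob_stage[OF Y W] ibang_hom] F_const[OF Y Lg] by simp
      finally show ?thesis .
    qed
    have 4: "(point_pairing X Y \<cdot> Far L g) \<star> Fa ?Z (Pr2 B X Y) = iid C \<cdot> Fo ?Z Y"
      using icomp_stage[OF p(1) F_ar_stage[OF pr(2) W] Lg] Fa_const[OF pr(2) Lg] p(3)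
        comp_assoc[OF Lg F_ob_stage[OF Y W] iid_hom] F_const[OF Y Lg] by simp
    have x: "(ibang C \<cdot> Fo ?Z Y) \<star> (\<iota> X \<cdot> Far L g) \<in> ielem B C ?Z (Fo ?Z Y) (Fo ?Z X)"
      by (rule icomp_ielem[OF bg iota_elem[OF X Lg]])
    show ?thesis
      using F_prd_ex1[OF X Y x iid_ielem[OF F_ob_stage[OF Y Z]]] icomp_ielem[OF p'(1) Fm] stage 1 2 3 4 by blast
  qed
  note q' = partial_app[OF X' Y comp_hom[OF m(1) f]] and q = partial_app[OF X Y f]
  note ho = ihom_object(1)[OF F_ob[OF Y] F_ob[OF A]]
  have "partial_app X' Y A (f \<cdot> m) = partial_app X Y A f \<cdot> Far L g"
  proof (rule hom_object_mono[OF ho F_ob[OF Y] F_ob[OF A] q'(1) comp_hom[OF Lg q(1)]])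
    have "ihom_incl B C (Fob F Y) (Fob F A) \<cdot> partial_app X' Y A (f \<cdot> m) = (point_pairing X Y \<cdot> Far L g) \<star> Fa ?Z f"
      unfolding q'(2) F_comp_stage[OF m(1) f Z] pm[symmetric]
      by (rule icomp_assoc[OF p'(1) Fm Ff, symmetric])
    also have "\<dots> = (point_pairing X Y \<star> Fa ?W f) \<cdot> Far L g"
      using icomp_stage[OF p(1) F_ar_stage[OF f W] Lg] Fa_const[OF f Lg] by simp
    also have "\<dots> = ihom_incl B C (Fob F Y) (Fob F A) \<cdot> partial_app X Y A f \<cdot> Far L g"
      using comp_assoc[OF Lg q(1) hom_objectD(2)[OF ho]] q(2) by simp
    finally show "ihom_incl B C (Fob F Y) (Fob F A) \<cdot> partial_app X' Y A (f \<cdot> m) =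
      ihom_incl B C (Fob F Y) (Fob F A) \<cdot> partial_app X Y A f \<cdot> Far L g" .
  qed
  then show ?thesis by (simp add: m_def)
qed

text \<open>Precomposing \<langle>b \<circ> !, id\<rangle> with \<open>y\<close> : \<open>1\<close>
  \<rightarrow> \<open>FY\<close> gives the point \<langle>b, y\<rangle>. The right side names the
  same element of \<box>(X \<times> Y), since both have projections \<open>b\<close> and
  \<open>y\<close>.\<close>

lemma point_pairing_apply:
  assumes X: "X \<in> Obj B" and Y: "Y \<in> Obj B" and y: "y \<in> Hom B (Fob L X) (Fob L Y)"
  shows "(\<iota> Y \<cdot> y) \<star> point_pairing X Y =
    \<iota> (Prd B X Y) \<cdot> (prod_iso B B L X Y \<cdot> pair B (Id B (Fob L X)) y)"
proof -
  let ?Z = "Fob L X"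
  have Z: "?Z \<in> Obj B" using L_ob[OF X] .
  note i = id_hom[OF Z] and pr = pr_hom[OF X Y] and qr = pr_hom[OF Z L_ob[OF Y]] and P = prd_obj[OF X Y]
  note pa = pair_props[OF i y] and k = prod_iso_props[OF X Y]
  note m = comp_hom[OF pa(1) k(1)]
  let ?m = "prod_iso B B L X Y \<cdot> pair B (Id B ?Z) y"
  have m1: "Far L (Pr1 B X Y) \<cdot> ?m = Id B ?Z" and m2: "Far L (Pr2 B X Y) \<cdot> ?m = y"
    using comp_assoc[OF pa(1) k(1) L_far(1)[OF pr(1)]] comp_assoc[OF pa(1) k(1) L_far(1)[OF pr(2)]] k pa by simp_all
  note p = point_pairing[OF X Y] and yel = iota_elem[OF Y y] and iX = iota_hom[OF X]
  note iel = hom_objectD(1)[OF iota_hom_object[OF X]] and bg = ibang_ielem[OF F_ob_stage[OF Y Z]]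
  \<comment> \<open>The composite \<open>1\<close> \<rightarrow> \<open>FY\<close> \<rightarrow>
    \<open>1\<close> is the identity.\<close>
  have b: "(\<iota> Y \<cdot> y) \<star> (ibang C \<cdot> Fo ?Z Y) = iid C \<cdot> (itrm C \<cdot> bang B ?Z)"
    by (rule to_itrm_unique[OF icomp_ielem[OF yel bg] iid_ielem[OF comp_hom[OF bang_hom[OF Z] itrm_hom]]])
  have 1: "((\<iota> Y \<cdot> y) \<star> point_pairing X Y) \<star> Fa ?Z (Pr1 B X Y) = \<iota> X"
    using icomp_assoc[OF yel p(1) F_ar_stage[OF pr(1) Z]] p(2) icomp_assoc[OF yel bg iel] b icomp_iid_left[OF iel]
    by simp
  have 2: "((\<iota> Y \<cdot> y) \<star> point_pairing X Y) \<star> Fa ?Z (Pr2 B X Y) = \<iota> Y \<cdot> y"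
    using icomp_assoc[OF yel p(1) F_ar_stage[OF pr(2) Z]] p(3) icomp_iid_right[OF yel] by simp
  have 3: "(\<iota> (Prd B X Y) \<cdot> ?m) \<star> Fa ?Z (Pr1 B X Y) = \<iota> X"
    using L_far_elem[OF pr(1) m] m1 id_right[OF iX] by simp
  have 4: "(\<iota> (Prd B X Y) \<cdot> ?m) \<star> Fa ?Z (Pr2 B X Y) = \<iota> Y \<cdot> y"
    using L_far_elem[OF pr(2) m] m2 by simp
  show ?thesis
    using F_prd_ex1[OF X Y iel yel] icomp_ielem[OF yel p(1)] iota_elem[OF P m] 1 2 3 4 by blast
qed

end

lemma fctr_comp_functor:
  assumes "is_functor B B' S" and "is_functor B' B'' T"
  shows "is_functor B B'' (fctr_comp T S)"
proof -
  interpret S: is_functor B B' S by fact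
  interpret T: is_functor B' B'' T by fact
  show ?thesis
  proof
    show "Far (fctr_comp T S) (g \<cdot>\<^bsub>B\<^esub> f) = Far (fctr_comp T S) g \<cdot>\<^bsub>B''\<^esub> Far (fctr_comp T S) f"
      if "f \<in> Hom B X Y" "g \<in> Hom B Y Z" for f X Y g Z
      unfolding fctr_comp_def using S.far_comp[OF that] T.far_comp[OF S.far[OF that(1)] S.far[OF that(2)]] by simp
  qed (simp_all add: fctr_comp_def S.fob T.fob S.far T.far S.far_id T.far_id)
qed

section \<open>The fixed-point operator and its laws\<close>

context geminal_category
begin

lemma delta_nat_trans: "nat_trans B B L (fctr_comp L L) \<delta>"
proof -
  interpret LF: is_functor B B L by (rule L_functor)
  interpret LL: is_functor B B "fctr_comp L L" by (rule fctr_comp_functor[OF L_functor L_functor])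
  show ?thesis
    by unfold_locales (simp_all add: fctr_comp_def delta_hom delta_natural)
qed

text \<open>One solution is selected for each \<open>A\<close>, before any parameter object or
  \<open>f\<close> is given; naturality in the parameter depends on this uniform choice.\<close>

definition loeb_op :: "'o \<Rightarrow> 'm" where
  "loeb_op A = (SOME y. y \<in> Hom B (ihom B C (Fob F (Fob L A)) (Fob F A)) (Fob L A) \<and>
    \<iota> A \<cdot> y = (\<iota> (Fob L A) \<cdot> (\<delta> A \<cdot> y)) \<star> ihom_incl B C (Fob F (Fob L A)) (Fob F A))"

lemma loeb_op:
  assumes "A \<in> Obj B"
  shows "loeb_op A \<in> Hom B (ihom B C (Fob F (Fob L A)) (Fob F A)) (Fob L A)"
    and "\<iota> A \<cdot> loeb_op A = (\<iota> (Fob L A) \<cdot> (\<delta> A \<cdot> loeb_op A)) \<star> ihom_incl B C (Fob F (Fob L A)) (Fob F A)"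
proof -
  have "\<exists>y. y \<in> Hom B (ihom B C (Fob F (Fob L A)) (Fob F A)) (Fob L A) \<and>
    \<iota> A \<cdot> y = (\<iota> (Fob L A) \<cdot> (\<delta> A \<cdot> y)) \<star> ihom_incl B C (Fob F (Fob L A)) (Fob F A)"
    using loeb[OF assms] by blast
  from someI_ex[OF this, folded loeb_op_def]
  show "loeb_op A \<in> Hom B (ihom B C (Fob F (Fob L A)) (Fob F A)) (Fob L A)"
    "\<iota> A \<cdot> loeb_op A = (\<iota> (Fob L A) \<cdot> (\<delta> A \<cdot> loeb_op A)) \<star> ihom_incl B C (Fob F (Fob L A)) (Fob F A)"
    by auto
qed

definition dagger :: "'o \<Rightarrow> 'o \<Rightarrow> 'm \<Rightarrow> 'm" where
  "dagger A X f = loeb_op A \<cdot> partial_app X (Fob L A) A f"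

lemma dagger_hom:
  assumes "A \<in> Obj B" "X \<in> Obj B" "f \<in> Hom B (Prd B X (Fob L A)) A"
  shows "dagger A X f \<in> Hom B (Fob L X) (Fob L A)"
  unfolding dagger_def
  by (rule comp_hom[OF partial_app(1)[OF assms(2) L_ob[OF assms(1)] assms(3)] loeb_op(1)[OF assms(1)]])

text \<open>The parameter enters only through \<open>partial_app\<close>, which is natural; the
  factor \<open>loeb_op A\<close> is fixed.\<close>

lemma dagger_natural:
  assumes A: "A \<in> Obj B" and X: "X \<in> Obj B" and g: "g \<in> Hom B X' X"
    and f: "f \<in> Hom B (Prd B X (Fob L A)) A"
  shows "dagger A X' (f \<cdot> prod_map B g (Id B (Fob L A))) = dagger A X f \<cdot> Far L g"
  unfolding dagger_def partial_app_natural[OF X L_ob[OF A] f g]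
    comp_assoc[OF L_far(1)[OF g] partial_app(1)[OF X L_ob[OF A] f] loeb_op(1)[OF A]] ..

text \<open>Restricting the equation of \<open>loeb_op\<close> along \<open>partial_app\<close>
  replaces the generic \<open>g\<close> by \<open>Ff\<close> \<circ> \<langle>b \<circ> !,
  id\<rangle>. Its value at \<delta>(f\<dagger>b) is \<open>Ff\<close> at the point \<langle>b,
  \<delta>(f\<dagger>b)\<rangle>, by \<open>point_pairing_apply\<close>.\<close>

lemma dagger_fixed:
  assumes A: "A \<in> Obj B" and X: "X \<in> Obj B" and f: "f \<in> Hom B (Prd B X (Fob L A)) A"
  shows "dagger A X f =
    Far L f \<cdot> (prod_iso B B L X (Fob L A) \<cdot> pair B (Id B (Fob L X)) (\<delta> A \<cdot> dagger A X f))"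
proof -
  let ?y = "dagger A X f" and ?p = "partial_app X (Fob L A) A f"
    and ?g = "ihom_incl B C (Fob F (Fob L A)) (Fob F A)"
  note LA = L_ob[OF A] and Z = L_ob[OF X] and d = delta_hom[OF A] and l = loeb_op[OF A]
  note y = dagger_hom[OF A X f] and p = partial_app[OF X LA f]
  note dy = comp_hom[OF y d] and dl = comp_hom[OF l(1) d]
  note m = comp_hom[OF pair_hom[OF id_hom[OF Z] dy] prod_iso_props(1)[OF X LA]]
  note gel = hom_objectD(1)[OF ihom_object(1)[OF F_ob[OF LA] F_ob[OF A]]]
  show ?thesis
  proof (rule iota_mono[OF A y comp_hom[OF m L_far(1)[OF f]]])
    have "\<iota> A \<cdot> ?y = ((\<iota> (Fob L A) \<cdot> (\<delta> A \<cdot> loeb_op A)) \<star> ?g) \<cdot> ?p"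
      unfolding dagger_def using comp_assoc[OF p(1) l(1) iota_hom[OF A]] l(2) by simp
    also have "\<dots> = (\<iota> (Fob L A) \<cdot> (\<delta> A \<cdot> ?y)) \<star> (?g \<cdot> ?p)"
      unfolding dagger_def using icomp_stage[OF iota_elem[OF LA dl] gel p(1)]
        comp_assoc[OF p(1) dl iota_hom[OF LA]] comp_assoc[OF p(1) l(1) d] by simp
    also have "\<dots> = ((\<iota> (Fob L A) \<cdot> (\<delta> A \<cdot> ?y)) \<star> point_pairing X (Fob L A)) \<star> Fa (Fob L X) f"
      unfolding p(2)
      by (rule icomp_assoc[OF iota_elem[OF LA dy] point_pairing(1)[OF X LA] F_ar_stage[OF f Z], symmetric])
    finally show "\<iota> A \<cdot> ?y = \<iota> A \<cdot> (Far L f \<cdot> (prod_iso B B L X (Fob L A) \<cdot>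
        pair B (Id B (Fob L X)) (\<delta> A \<cdot> ?y)))"
      unfolding point_pairing_apply[OF X LA dy] L_far_elem[OF f m] .
  qed
qed

end

theorem theorem6p16:
  fixes B :: "('o, 'm) lexcat" and C :: "('o, 'm) ilexcat"
    and F :: "('o, 'm, 'm, 'm) fctr" and H :: "'m ifun"
    and L :: "('o, 'm, 'o, 'm) fctr"
  assumes geminal: "geminal_category B C F H"
    and L: "L = Box B C F"
  shows "\<exists>(\<delta> :: 'o \<Rightarrow> 'm) (dag :: 'o \<Rightarrow> 'o \<Rightarrow> 'm \<Rightarrow> 'm).
    nat_trans B B L (fctr_comp L L) \<delta> \<and>
    (\<forall>A \<in> Obj B. \<delta> (Fob L A) \<cdot>\<^bsub>B\<^esub> \<delta> A = Far L (\<delta> A) \<cdot>\<^bsub>B\<^esub> \<delta> A) \<and>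
    (\<forall>A \<in> Obj B. \<forall>X \<in> Obj B. \<forall>f \<in> Hom B (Prd B X (Fob L A)) A.
      dag A X f \<in> Hom B (Fob L X) (Fob L A)) \<and>
    (\<forall>A \<in> Obj B. \<forall>X \<in> Obj B. \<forall>X' \<in> Obj B.
      \<forall>g \<in> Hom B X' X. \<forall>f \<in> Hom B (Prd B X (Fob L A)) A.
      dag A X' (f \<cdot>\<^bsub>B\<^esub> prod_map B g (Id B (Fob L A))) = dag A X f \<cdot>\<^bsub>B\<^esub> Far L g) \<and>
    (\<forall>A \<in> Obj B. \<forall>X \<in> Obj B. \<forall>f \<in> Hom B (Prd B X (Fob L A)) A.
      dag A X f =
        Far L f \<cdot>\<^bsub>B\<^esub> prod_iso B B L X (Fob L A) \<cdot>\<^bsub>B\<^esub>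
          pair B (Id B (Fob L X)) (\<delta> A \<cdot>\<^bsub>B\<^esub> dag A X f))"
proof -
  interpret geminal_category B C F H by (rule geminal)
  show ?thesis
    unfolding L using delta_nat_trans delta_coassoc dagger_hom dagger_natural dagger_fixed
    by (intro exI[of _ "sigma B C F H"] exI[of _ dagger] conjI ballI)
qed

end
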